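(* For each $n\ge 1$, the polynomial $h^*(\mathcal{O}(\mathcal{C}_{2n}),t)$ has a nonnegative expansion in the basis $\Gamma_{2n-2}=\{t^j(1+t)^{2n-2-2j}\}_{j=0}^{n-1}$; that is, there are nonnegative integers $\gamma_{2n,j}$ such that $$h^*(\mathcal{O}(\mathcal{C}_{2n}),t)=\sum_{0\le j\le n-1}\gamma_{2n,j}\,t^j(1+t)^{2n-2-2j},$$ and moreover $$\gamma_{2n,j}=2^{-2n+2+2j}\,\bigl|\{\pi\in \mathrm{JH}(\tilde{\mathcal{C}}_{2n},\tilde\omega) : \mathrm{peak}(\pi)=j+1\}\bigr|,$$ where $\omega$ is any natural labeling of $\mathcal{C}_{2n}$ and $(\tilde{\mathcal{C}}_{2n},\tilde\omega)$ is any canonically labeled poset obtained from $(\mathcal{C}_{2n},\omega)$ by adjoining a greatest element.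
   Context: The crown poset $\mathcal{C}_{2n}$ is the poset on $[2n]$ with cover relations $1\prec 2\succ 3\prec\cdots\succ 2n-1\prec 2n\succ 1$ (for $n=1$ it is the chain $1\prec 2$). The order polytope of a poset $P=([d],\preceq)$ is $\mathcal{O}(P)=\{x\in[0,1]^d : x_i\le x_j \text{ whenever } i\preceq j\}$. For a $d$-dimensional lattice polytope $\mathfrak{p}\subseteq\mathbb{R}^d$, $h^*(\mathfrak{p},t)$ is the polynomial of degree at most $d$ with $1+\sum_{k\ge1}\#(k\mathfrak{p}\cap\mathbb{Z}^d)\,t^k = h^*(\mathfrak{p},t)/(1-t)^{d+1}$. A labeling of a finite poset $P$ is an injection $\omega:P\to\mathbb{Z}$; it is natural if $x\le_P y$ implies $\omega(x)\le\omega(y)$. For a labeled poset $(P,\omega)$ and a cover relation $x\prec y$ put $\varepsilon(x,y)=1$ if $\omega(x)<\omega(y)$ and $\varepsilon(x,y)=-1$ otherwise. The labeling is canonical if there is a well-defined rank function $\rho$, $\rho(x)=\sum_{i=1}^{k}\varepsilon(x_{i-1},x_i)$ for every saturated chain $x_0\prec x_1\prec\cdots\prec x_k=x$ with $x_0$ minimal, this $\rho$ takes values in $\{0,1\}$, and $\rho(x)<\rho(y)$ implies $\omega(x)<\omega(y)$. Let $\tilde{\mathcal{C}}_{2n}$ be $\mathcal{C}_{2n}$ with a greatest element $\hat 1$ adjoined. A canonical labeling $\tilde\omega$ of $\tilde{\mathcal{C}}_{2n}$ is thus an injection $\tilde\omega:\tilde{\mathcal{C}}_{2n}\to\mathbb{Z}$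 such that the labels of all minimal elements of $\mathcal{C}_{2n}$ and of $\hat 1$ (where $\rho=0$) are smaller than the labels of all maximal elements of $\mathcal{C}_{2n}$ (where $\rho=1$). $\mathrm{JH}(\tilde{\mathcal{C}}_{2n},\tilde\omega)$ is the set of words $\tilde\omega(x_1)\tilde\omega(x_2)\cdots\tilde\omega(x_{2n+1})$, where $x_1,\dots,x_{2n+1}$ ranges over all linear extensions of $\tilde{\mathcal{C}}_{2n}$ (orderings of its elements in which $x_i\preceq x_j$ implies $i\le j$). For a word $\pi=a_1a_2\cdots a_N$ of distinct integers, $\mathrm{peak}(\pi)=|\{i : 1<i<N,\ a_{i-1}<a_i>a_{i+1}\}|$. *)

theory Defs
  imports "HOL-Computational_Algebra.Computational_Algebra"
begin

text \<open>A poset is given by its reflexive order relation \<open>r\<close>, as in \<open>HOL.Order_Relation\<close>;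
  its ground set is \<open>Field r\<close>.\<close>

subsection \<open>Posets and labelings\<close>

definition covered_by :: "'a rel \<Rightarrow> 'a \<Rightarrow> 'a \<Rightarrow> bool" where
  "covered_by r x y \<longleftrightarrow>
     (x, y) \<in> r \<and> x \<noteq> y \<and> (\<forall>z. (x, z) \<in> r \<and> (z, y) \<in> r \<longrightarrow> z = x \<or> z = y)"

definition minimal_in :: "'a rel \<Rightarrow> 'a \<Rightarrow> bool" where
  "minimal_in r x \<longleftrightarrow> x \<in> Field r \<and> (\<forall>y. (y, x) \<in> r \<longrightarrow> y = x)"

definition labeling :: "'a rel \<Rightarrow> ('a \<Rightarrow> int) \<Rightarrow> bool" where
  "labeling r \<omega> \<longleftrightarrow> inj_on \<omega> (Field r)"

definition natural_labeling :: "'a rel \<Rightarrow> ('a \<Rightarrow> int) \<Rightarrow> bool" where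
  "natural_labeling r \<omega> \<longleftrightarrow> labeling r \<omega> \<and> (\<forall>(x, y) \<in> r. \<omega> x \<le> \<omega> y)"

definition edge_sign :: "('a \<Rightarrow> int) \<Rightarrow> 'a \<Rightarrow> 'a \<Rightarrow> int" where
  "edge_sign \<omega> x y = (if \<omega> x < \<omega> y then 1 else -1)"

definition saturated_chain_from_min :: "'a rel \<Rightarrow> 'a list \<Rightarrow> bool" where
  "saturated_chain_from_min r xs \<longleftrightarrow>
     xs \<noteq> [] \<and> minimal_in r (hd xs) \<and> successively (covered_by r) xs"

definition canonical_labeling :: "'a rel \<Rightarrow> ('a \<Rightarrow> int) \<Rightarrow> bool" where
  "canonical_labeling r \<omega> \<longleftrightarrow> labeling r \<omega> \<and>
     (\<exists>\<rho> :: 'a \<Rightarrow> int.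
        (\<forall>xs. saturated_chain_from_min r xs \<longrightarrow>
           \<rho> (last xs) = (\<Sum>i<length xs - 1. edge_sign \<omega> (xs ! i) (xs ! Suc i))) \<and>
        (\<forall>x \<in> Field r. \<rho> x \<in> {0, 1}) \<and>
        (\<forall>x \<in> Field r. \<forall>y \<in> Field r. \<rho> x < \<rho> y \<longrightarrow> \<omega> x < \<omega> y))"

text \<open>The new greatest element is \<open>None\<close>.\<close>

definition adjoin_top :: "'a rel \<Rightarrow> 'a option rel" where
  "adjoin_top r = {(Some x, Some y) | x y. (x, y) \<in> r}
     \<union> {(Some x, None) | x. x \<in> Field r} \<union> {(None, None)}"

definition linear_extension :: "'a rel \<Rightarrow> 'a list \<Rightarrow> bool" where
  "linear_extension r xs \<longleftrightarrow> distinct xs \<and> set xs = Field r \<and>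
     (\<forall>i < length xs. \<forall>j < length xs. (xs ! i, xs ! j) \<in> r \<longrightarrow> i \<le> j)"

text \<open>The Jordan--Hoelder set of a labeled poset.\<close>

definition JH :: "'a rel \<Rightarrow> ('a \<Rightarrow> int) \<Rightarrow> int list set" where
  "JH r \<omega> = {map \<omega> xs | xs. linear_extension r xs}"

text \<open>Positions in a word are counted from 0 here.\<close>

definition peak :: "int list \<Rightarrow> nat" where
  "peak a = card {i. 0 < i \<and> i + 1 < length a \<and> a ! (i - 1) < a ! i \<and> a ! i > a ! (i + 1)}"

subsection \<open>The crown poset on \<open>{1..2n}\<close>\<close>

definition crown_covers :: "nat \<Rightarrow> nat rel" where
  "crown_covers n = {(2*i - 1, 2*i) | i. 1 \<le> i \<and> i \<le> n}
     \<union> {(2*i + 1, 2*i) | i. 1 \<le> i \<and> i < n} \<union> {(1, 2*n)}"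

definition crown :: "nat \<Rightarrow> nat rel" where
  "crown n = Id_on {1..2*n} \<union> (crown_covers n)\<^sup>+"

subsection \<open>Order polytopes and the \<open>h\<^sup>*\<close>-polynomial\<close>

text \<open>A point with coordinates indexed by a finite set \<open>A\<close> is a function that vanishes
  outside \<open>A\<close>; in particular \<open>\<real>\<close>-space of dimension \<open>d\<close> consists of the functions
  \<open>nat \<Rightarrow> real\<close> that vanish outside \<open>{1..d}\<close>.\<close>

definition order_polytope :: "'a rel \<Rightarrow> ('a \<Rightarrow> real) set" where
  "order_polytope r = {x. (\<forall>i. i \<notin> Field r \<longrightarrow> x i = 0) \<and>
     (\<forall>i \<in> Field r. 0 \<le> x i \<and> x i \<le> 1) \<and> (\<forall>(i, j) \<in> r. x i \<le> x j)}"

definition lattice_points_dilate :: "nat \<Rightarrow> ('a \<Rightarrow> real) set \<Rightarrow> ('a \<Rightarrow> real) set" where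
  "lattice_points_dilate k P = {y \<in> (\<lambda>x i. real k * x i) ` P. \<forall>i. y i \<in> \<int>}"

definition ehrhart_series :: "('a \<Rightarrow> real) set \<Rightarrow> real fps" where
  "ehrhart_series P =
     Abs_fps (\<lambda>k. if k = 0 then 1 else of_nat (card (lattice_points_dilate k P)))"

text \<open>\<open>d\<close> is the dimension of the lattice polytope \<open>P\<close>.\<close>

definition h_star :: "nat \<Rightarrow> ('a \<Rightarrow> real) set \<Rightarrow> real poly" where
  "h_star d P = (THE h. degree h \<le> d \<and>
     ehrhart_series P = fps_of_poly h / (1 - fps_X) ^ (d + 1))"

end

theory Submission
  imports Defs "HOL-Library.Product_Lexorder"
begin

text \<open>
  The proof has two independent halves: a descent formula for the \<open>h\<^sup>*\<close>-polynomial of an order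
  polytope, and a symmetrization of descents in the words of a canonically labeled crown.

  \<^emph>\<open>Descents.\<close> The lattice points of the \<open>k\<close>-th dilate of an order polytope are the
  order-preserving maps \<open>f\<close> into \<open>{0..k}\<close>. Sorting the elements by \<open>f\<close>, with ties
  broken by a natural labeling \<open>\<omega>\<close>, produces a linear extension along which \<open>f\<close> increases
  weakly, and strictly at every descent of the \<open>\<omega>\<close>-labels. So the lattice points split into
  blocks indexed by the linear extensions, and a block of an extension with \<open>e\<close> descents has
  generating function \<open>t^e / (1 - t)^(d + 1)\<close>. This is the theory of \<open>P\<close>-partitions; it gives
  \<open>h_star_order_polytope\<close>. Appending the label of the greatest element, which lies below the
  labels of all maximal elements of the crown, adds exactly one descent to every word.

  \<^emph>\<open>Symmetrization.\<close> A canonical labeling puts all labels of minimal elements, and that of the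
  greatest element, below all labels of maximal elements. Give every letter of a word two bits:
  whether its left neighbour is smaller and whether its right neighbour is smaller. Descents are
  the letters with the second bit, peaks those with both, and the number of letters with exactly
  one bit is \<open>d - 2 i\<close> when there are \<open>i\<close> peaks. Around a letter \<open>x\<close> take the
  maximal runs of smaller letters if \<open>x\<close> labels a minimal element, and of larger letters if it
  labels a maximal one. Exchanging the two runs interchanges the bits of \<open>x\<close> and
  keeps those of every other letter; this is the Foata--Strehl action, applied in one direction
  on the lower level and upside down on the upper level. The letters that move all label elements
  of one level, which are pairwise incomparable, so the word still comes from a linear extension.
  Symmetrizing one letter after the other yields, for the words with \<open>i\<close> peaks,
  \<open>\<Sum> t^des = N\<^sub>i t^i ((1 + t) / 2)^(d - 2 i)\<close>, with \<open>N\<^sub>i\<close> the number of these words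
  (\<open>peak_class_symmetrized\<close>). Keeping only the words without double descents
  shows that \<open>N\<^sub>i / 2^(d - 2 i)\<close> is a natural number. Summation over \<open>i = j + 1\<close>
  is the expansion sought, \<open>descent_polynomial_gamma\<close>.

  Finally the coefficients cannot depend on the labeling, because the polynomials
  \<open>t^j (1 + t)^(m - 2 j)\<close> are linearly independent and the \<open>h\<^sup>*\<close>-polynomial does not
  refer to any labeling. The argument is carried out for posets in which every element is either
  minimal or maximal and none is both, the setting of the locale \<open>two_level_poset\<close>.
\<close>

section \<open>Order polytopes: the \<open>h\<^sup>*\<close>-polynomial counts linear extensions by descents\<close>

definition des :: "'a::linorder list \<Rightarrow> nat" where
  "des w = card {i. i + 1 < length w \<and> w ! i > w ! (i + 1)}"

lemma des_append_last:
  assumes "w \<noteq> []"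
  shows "des (w @ [z]) = des w + (if last w > z then 1 else 0)"
proof -
  let ?D = "{i. i + 1 < length w \<and> w ! i > w ! (i + 1)}"
  have "{i. i + 1 < length (w @ [z]) \<and> (w @ [z]) ! i > (w @ [z]) ! (i + 1)} =
    ?D \<union> (if last w > z then {length w - 1} else {})" (is "?E = _")
  proof (intro set_eqI)
    fix i
    consider "i + 1 < length w" | "i = length w - 1" | "i \<ge> length w" by linarith
    then show "i \<in> ?E \<longleftrightarrow> i \<in> ?D \<union> (if last w > z then {length w - 1} else {})"
      using assms by cases (auto simp: nth_append last_conv_nth Suc_le_eq simp flip: length_greater_0_conv)
  qed
  moreover have "finite ?D" by (rule finite_subset[of _ "{..<length w}"]) auto
  moreover have "length w - 1 \<notin> ?D" using assms by auto
  ultimately show ?thesis by (simp add: des_def card_insert_if)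
qed

lemma des_le_length: "des w \<le> length w"
proof -
  have "des w \<le> card {..<length w}"
    unfolding des_def by (intro card_mono) auto
  then show ?thesis by simp
qed

definition linear_extensions :: "'a rel \<Rightarrow> 'a list set" where
  "linear_extensions r = {xs. linear_extension r xs}"

lemma linear_extensions_iff:
  "xs \<in> linear_extensions r \<longleftrightarrow>
     distinct xs \<and> set xs = Field r \<and> sorted_wrt (\<lambda>x y. (y, x) \<notin> r) xs"
  unfolding linear_extensions_def linear_extension_def sorted_wrt_iff_nth_less
  by (smt (verit, best) less_trans mem_Collect_eq not_le)

lemma finite_linear_extensions:
  assumes "finite (Field r)"
  shows "finite (linear_extensions r)"
  by (rule finite_subset[OF _ finite_lists_length_eq[OF assms, of "card (Field r)"]])
     (auto simp: linear_extensions_iff distinct_card[symmetric])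

definition order_maps :: "'a rel \<Rightarrow> nat \<Rightarrow> ('a \<Rightarrow> nat) set" where
  "order_maps r k = {f. (\<forall>v. v \<notin> Field r \<longrightarrow> f v = 0) \<and> (\<forall>v \<in> Field r. f v \<le> k) \<and>
     (\<forall>(u, v) \<in> r. f u \<le> f v)}"

text \<open>The maps compatible with a list: their values together with the labels, compared
  lexicographically, increase strictly along the list. So the values increase weakly, and strictly
  across every descent of the labels.\<close>
definition sorted_maps :: "('a \<Rightarrow> int) \<Rightarrow> 'a list \<Rightarrow> nat \<Rightarrow> ('a \<Rightarrow> nat) set" where
  "sorted_maps \<omega> xs k = {f. (\<forall>v. v \<notin> set xs \<longrightarrow> f v = 0) \<and> (\<forall>v \<in> set xs. f v \<le> k) \<and>
     sorted_wrt (\<lambda>u v. f u < f v \<or> f u = f v \<and> \<omega> u < \<omega> v) xs}"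

lemma finite_sorted_maps: "finite (sorted_maps \<omega> xs k)"
  by (rule finite_subset[OF _ finite_set_of_finite_funs[of "set xs" "{..k}" 0]])
     (auto simp: sorted_maps_def)

text \<open>Stanley's decomposition. A map is compatible with the list that sorts the elements by
  value and then by label, and naturality of the labeling makes this list a linear extension.\<close>
lemma order_maps_eq_UN_sorted_maps:
  assumes fin: "finite (Field r)" and nat: "natural_labeling r \<omega>"
  shows "order_maps r k = (\<Union>xs \<in> linear_extensions r. sorted_maps \<omega> xs k)"
proof (intro equalityI subsetI)
  have inj: "inj_on \<omega> (Field r)" and mono: "\<And>u v. (u, v) \<in> r \<Longrightarrow> \<omega> u \<le> \<omega> v"
    using nat by (auto simp: natural_labeling_def labeling_def)
  {
    fix f assume f: "f \<in> order_maps r k"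
    define key where "key v = (f v, \<omega> v)" for v
    obtain vs where vs: "set vs = Field r" "distinct vs"
      using finite_distinct_list[OF fin] by blast
    define xs where "xs = sort_key key vs"
    have set: "set xs = Field r" and dist: "distinct xs" using vs by (simp_all add: xs_def)
    have injkey: "inj_on key (set xs)"
      using inj by (auto simp: set key_def inj_on_def)
    have "sorted_wrt (<) (map key xs)"
      by (subst strict_sorted_iff) (simp add: xs_def[symmetric] distinct_map dist injkey, simp add: xs_def)
    then have srt: "sorted_wrt (\<lambda>u v. f u < f v \<or> f u = f v \<and> \<omega> u < \<omega> v) xs"
      by (auto simp: sorted_wrt_map key_def elim!: sorted_wrt_mono_rel[rotated])
    \<comment> \<open>If the later of two elements were below the earlier one, both
      its value and its label would be at most as large.\<close>
    have "sorted_wrt (\<lambda>x y. (y, x) \<notin> r) xs"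
      using f mono by (intro sorted_wrt_mono_rel[OF _ srt]) (fastforce simp: order_maps_def)
    then have "xs \<in> linear_extensions r" by (simp add: linear_extensions_iff dist set)
    moreover have "f \<in> sorted_maps \<omega> xs k"
      using f srt by (auto simp: sorted_maps_def order_maps_def set)
    ultimately show "f \<in> (\<Union>xs \<in> linear_extensions r. sorted_maps \<omega> xs k)" by blast
  }
  {
    fix f assume "f \<in> (\<Union>xs \<in> linear_extensions r. sorted_maps \<omega> xs k)"
    then obtain xs where xs: "xs \<in> linear_extensions r" and f: "f \<in> sorted_maps \<omega> xs k" by blast
    from xs have set: "set xs = Field r" and ext: "sorted_wrt (\<lambda>x y. (y, x) \<notin> r) xs"
      by (auto simp: linear_extensions_iff)
    have srt: "sorted_wrt (\<lambda>u v. f u < f v \<or> f u = f v \<and> \<omega> u < \<omega> v) xs"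
      using f by (simp add: sorted_maps_def)
    have "f u \<le> f v" if uv: "(u, v) \<in> r" for u v
    proof -
      have "u \<in> set xs" "v \<in> set xs" using uv by (auto simp: set Field_def)
      then obtain i j where ij: "i < length xs" "j < length xs" "u = xs ! i" "v = xs ! j"
        by (metis in_set_conv_nth)
      have "\<not> j < i" using ext uv ij by (auto simp: sorted_wrt_iff_nth_less)
      then consider "i = j" | "i < j" by linarith
      then show ?thesis
      proof cases
        case 2
        then show ?thesis using sorted_wrt_nth_less[OF srt 2] ij by auto
      qed (simp add: ij)
    qed
    then show "f \<in> order_maps r k"
      using f by (auto simp: order_maps_def sorted_maps_def set)
  }
qed

lemma sorted_maps_determine_list:
  assumes "f \<in> sorted_maps \<omega> xs k" "f \<in> sorted_maps \<omega> ys k" "set xs = set ys"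
  shows "xs = ys"
proof -
  define key where "key v = (f v, \<omega> v)" for v
  have srt: "sorted_wrt (<) (map key zs)" if "f \<in> sorted_maps \<omega> zs k" for zs
    using that by (auto simp: sorted_maps_def sorted_wrt_map key_def elim!: sorted_wrt_mono_rel[rotated])
  have "map key xs = map key ys"
    using srt[OF assms(1)] srt[OF assms(2)] assms(3)
    by (intro strict_sorted_equal) auto
  moreover have "inj_on key (set xs \<union> set ys)"
    using srt[OF assms(1)] assms(3) by (simp add: strict_sorted_iff distinct_map)
  ultimately show ?thesis by (rule map_inj_on)
qed

text \<open>Division by \<open>1 - t\<close> takes partial sums, which is what choosing the value at the last element of
  a list amounts to.\<close>
lemma fps_partial_sums:
  "Abs_fps (\<lambda>k. \<Sum>m\<le>k. a m) * (1 - fps_X) = Abs_fps (a :: nat \<Rightarrow> real)"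
proof (rule fps_ext)
  fix k show "(Abs_fps (\<lambda>k. \<Sum>m\<le>k. a m) * (1 - fps_X)) $ k = Abs_fps a $ k"
    by (cases k) (simp_all add: algebra_simps)
qed

text \<open>The recursion behind the generating function: after choosing the value \<open>m\<close> at the last
  element, the remaining values are bounded by \<open>m\<close>, or by \<open>m - 1\<close> if the last step is a descent.\<close>
lemma sorted_maps_append_last:
  assumes z: "z \<notin> set xs" and inj: "inj_on \<omega> (insert z (set xs))"
  defines "T \<equiv> \<lambda>m. if xs = [] \<or> \<omega> (last xs) < \<omega> z then sorted_maps \<omega> xs m
     else if m = 0 then {} else sorted_maps \<omega> xs (m - 1)"
  shows "card (sorted_maps \<omega> (xs @ [z]) k) = (\<Sum>m\<le>k. card (T m))"
proof -
  let ?R = "\<lambda>f u v. (f u :: nat) < f v \<or> f u = f v \<and> \<omega> u < \<omega> v"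
  \<comment> \<open>Comparing all elements with the new one is the same as comparing only the last of them.\<close>
  have T: "g \<in> T m \<longleftrightarrow> (\<forall>v. v \<notin> set xs \<longrightarrow> g v = 0) \<and> sorted_wrt (?R g) xs \<and>
      (\<forall>v \<in> set xs. ?R (g(z := m)) v z)" for g m
  proof (cases "xs = []")
    case True
    then show ?thesis by (auto simp: T_def sorted_maps_def)
  next
    case False
    have wz: "\<omega> (last xs) \<noteq> \<omega> z" using inj z False by (metis inj_onD insert_iff last_in_set)
    have last: "v = last xs \<or> ?R g v (last xs)" if "sorted_wrt (?R g) xs" "v \<in> set xs" for v
    proof -
      have xs: "xs = butlast xs @ [last xs]" using False by simp
      have "v \<in> set (butlast xs @ [last xs])" using that(2) xs by simp
      moreover have "sorted_wrt (?R g) (butlast xs @ [last xs])" using that(1) xs by simp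
      ultimately show ?thesis by (auto simp: sorted_wrt_append)
    qed
    have lastin: "last xs \<in> set xs" using False by simp
    show ?thesis
    proof (cases "\<omega> (last xs) < \<omega> z")
      case True
      have E: "(\<forall>v \<in> set xs. g v \<le> m) \<longleftrightarrow> (\<forall>v \<in> set xs. ?R (g(z := m)) v z)"
        if s: "sorted_wrt (?R g) xs"
      proof
        assume le: "\<forall>v \<in> set xs. g v \<le> m"
        show "\<forall>v \<in> set xs. ?R (g(z := m)) v z"
        proof
          fix v assume v: "v \<in> set xs"
          have "v \<noteq> z" using v z by auto
          then show "?R (g(z := m)) v z"
            using last[OF s v] le[rule_format, OF v] le[rule_format, OF lastin] True by auto
        qed
      next
        assume le: "\<forall>v \<in> set xs. ?R (g(z := m)) v z"
        show "\<forall>v \<in> set xs. g v \<le> m"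
        proof
          fix v assume "v \<in> set xs"
          with le z show "g v \<le> m" by (cases "v = z") auto
        qed
      qed
      have "g \<in> T m \<longleftrightarrow> (\<forall>v. v \<notin> set xs \<longrightarrow> g v = 0) \<and> (\<forall>v \<in> set xs. g v \<le> m) \<and>
          sorted_wrt (?R g) xs"
        using True by (simp add: T_def sorted_maps_def)
      then show ?thesis using E by blast
    next
      case nless: False
      have E: "(0 < m \<and> (\<forall>v \<in> set xs. g v \<le> m - 1)) \<longleftrightarrow> (\<forall>v \<in> set xs. ?R (g(z := m)) v z)"
        if s: "sorted_wrt (?R g) xs"
      proof
        assume le: "\<forall>v \<in> set xs. ?R (g(z := m)) v z"
        have "last xs \<noteq> z" using lastin z by auto
        then have *: "g (last xs) < m" using le lastin nless by fastforce
        have "g v \<le> m - 1" if v: "v \<in> set xs" for v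
          using last[OF s v] * by auto
        then show "0 < m \<and> (\<forall>v \<in> set xs. g v \<le> m - 1)" using * by auto
      next
        assume le: "0 < m \<and> (\<forall>v \<in> set xs. g v \<le> m - 1)"
        show "\<forall>v \<in> set xs. ?R (g(z := m)) v z"
        proof
          fix v assume v: "v \<in> set xs"
          then have "g v \<le> m - 1" using le by blast
          with le v z show "?R (g(z := m)) v z" by (cases "v = z") auto
        qed
      qed
      have "g \<in> T m \<longleftrightarrow> (\<forall>v. v \<notin> set xs \<longrightarrow> g v = 0) \<and>
          (0 < m \<and> (\<forall>v \<in> set xs. g v \<le> m - 1)) \<and> sorted_wrt (?R g) xs"
        using nless False by (simp add: T_def sorted_maps_def)
      then show ?thesis using E by blast
    qed
  qed
  have fin: "finite (T m)" for m by (simp add: T_def finite_sorted_maps)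
  have upd: "sorted_wrt (?R (f(z := m))) xs = sorted_wrt (?R f) xs" for f m
    using z by (induction xs) auto
  have "bij_betw (\<lambda>(m, g). g(z := m)) (SIGMA m:{..k}. T m) (sorted_maps \<omega> (xs @ [z]) k)"
  proof (rule bij_betw_byWitness[where f' = "\<lambda>f. (f z, f(z := 0))"])
    show "\<forall>a \<in> SIGMA m:{..k}. T m. (\<lambda>f. (f z, f(z := 0))) ((\<lambda>(m, g). g(z := m)) a) = a"
      using z by (auto simp: T intro!: ext)
    show "\<forall>f \<in> sorted_maps \<omega> (xs @ [z]) k. (\<lambda>(m, g). g(z := m)) ((\<lambda>f. (f z, f(z := 0))) f) = f"
      by auto
    show "(\<lambda>(m, g). g(z := m)) ` (SIGMA m:{..k}. T m) \<subseteq> sorted_maps \<omega> (xs @ [z]) k"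
    proof clarsimp
      fix m g assume m: "m \<le> k" and g: "g \<in> T m"
      have le: "g v \<le> m" if v: "v \<in> set xs" for v
      proof -
        have "v \<noteq> z" using v z by auto
        moreover have "?R (g(z := m)) v z" using g v T by blast
        ultimately show ?thesis by auto
      qed
      then show "g(z := m) \<in> sorted_maps \<omega> (xs @ [z]) k"
        unfolding sorted_maps_def mem_Collect_eq set_append sorted_wrt_append upd
        using m g z le by (auto simp: T)
    qed
    show "(\<lambda>f. (f z, f(z := 0))) ` sorted_maps \<omega> (xs @ [z]) k \<subseteq> (SIGMA m:{..k}. T m)"
    proof (rule image_subsetI)
      fix f assume f: "f \<in> sorted_maps \<omega> (xs @ [z]) k"
      have "sorted_wrt (?R (f(z := 0))) xs"
        unfolding upd using f by (simp add: sorted_maps_def sorted_wrt_append)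
      moreover have "\<forall>v. v \<notin> set xs \<longrightarrow> (f(z := 0)) v = 0" "f z \<le> k"
        using f by (auto simp: sorted_maps_def)
      moreover have "\<forall>v \<in> set xs. ?R ((f(z := 0))(z := f z)) v z"
        using f by (auto simp: sorted_maps_def sorted_wrt_append)
      ultimately show "(f z, f(z := 0)) \<in> (SIGMA m:{..k}. T m)"
        unfolding T mem_Sigma_iff by blast
    qed
  qed
  then have "card (sorted_maps \<omega> (xs @ [z]) k) = card (SIGMA m:{..k}. T m)"
    by (simp add: bij_betw_same_card)
  then show ?thesis using fin by (simp add: card_SigmaI)
qed

lemma sorted_maps_series:
  assumes "distinct xs" "inj_on \<omega> (set xs)"
  shows "Abs_fps (\<lambda>k. real (card (sorted_maps \<omega> xs k))) * (1 - fps_X) ^ (length xs + 1) =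
     fps_X ^ des (map \<omega> xs)"
  using assms
proof (induction xs rule: rev_induct)
  case Nil
  have "sorted_maps \<omega> [] k = {\<lambda>_. 0}" for k by (auto simp: sorted_maps_def)
  then have "Abs_fps (\<lambda>k. real (card (sorted_maps \<omega> [] k))) =
      Abs_fps (\<lambda>k. \<Sum>m\<le>k. if m = 0 then 1 else 0)" by simp
  moreover have "Abs_fps (\<lambda>m. if m = 0 then 1 else 0) = (1 :: real fps)"
    by (rule fps_ext) simp
  ultimately show ?case using fps_partial_sums[of "\<lambda>m. if m = 0 then 1 else 0"]
    by (simp add: des_def)
next
  case (snoc z xs)
  let ?c = "\<lambda>xs k. real (card (sorted_maps \<omega> xs k))"
  let ?asc = "xs = [] \<or> \<omega> (last xs) < \<omega> z"
  define a where "a m = (if ?asc then ?c xs m else if m = 0 then 0 else ?c xs (m - 1))" for m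
  have z: "z \<notin> set xs" and inj: "inj_on \<omega> (insert z (set xs))" using snoc.prems by auto
  have IH: "Abs_fps (?c xs) * (1 - fps_X) ^ (length xs + 1) = fps_X ^ des (map \<omega> xs)"
    using snoc.prems by (intro snoc.IH) (auto simp: inj_on_insert)
  have "?c (xs @ [z]) k = (\<Sum>m\<le>k. a m)" for k
    unfolding sorted_maps_append_last[OF z inj] a_def by (auto intro!: sum.cong)
  then have "Abs_fps (?c (xs @ [z])) * (1 - fps_X) = Abs_fps a"
    by (simp add: fps_partial_sums)
  also have "Abs_fps a = (if ?asc then 1 else fps_X) * Abs_fps (?c xs)"
    by (rule fps_ext) (auto simp: a_def)
  finally have "Abs_fps (?c (xs @ [z])) * (1 - fps_X) ^ (length (xs @ [z]) + 1) =
      (if ?asc then 1 else fps_X) * (Abs_fps (?c xs) * (1 - fps_X) ^ (length xs + 1))"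
    by (simp add: mult_ac)
  also have "\<dots> = fps_X ^ des (map \<omega> (xs @ [z]))"
  proof (cases "xs = []")
    case True
    then show ?thesis unfolding IH by (simp add: des_def)
  next
    case False
    have "\<omega> (last xs) \<noteq> \<omega> z" using inj z False by (metis inj_onD insert_iff last_in_set)
    then show ?thesis unfolding IH using False
      by (auto simp: des_append_last last_map)
  qed
  finally show ?case .
qed

lemma card_lattice_points_order_polytope:
  assumes "k > 0"
  shows "card (lattice_points_dilate k (order_polytope r)) = card (order_maps r k)"
proof -
  have "bij_betw (\<lambda>f i. real (f i)) (order_maps r k) (lattice_points_dilate k (order_polytope r))"
    unfolding bij_betw_def
  proof (intro conjI equalityI subsetI)
    show "inj_on (\<lambda>f i. real (f i)) (order_maps r k)"
      by (rule inj_onI) (auto simp: fun_eq_iff)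
    fix y assume "y \<in> (\<lambda>f i. real (f i)) ` order_maps r k"
    then obtain f where f: "f \<in> order_maps r k" "y = (\<lambda>i. real (f i))" by blast
    define x where "x i = real (f i) / real k" for i
    have "x \<in> order_polytope r"
      using f(1) assms by (auto simp: x_def order_maps_def order_polytope_def divide_right_mono)
    moreover have "y = (\<lambda>i. real k * x i)" using f(2) assms by (simp add: x_def)
    ultimately have "y \<in> (\<lambda>x i. real k * x i) ` order_polytope r" by blast
    then show "y \<in> lattice_points_dilate k (order_polytope r)"
      by (simp add: lattice_points_dilate_def f(2))
  next
    fix y assume "y \<in> lattice_points_dilate k (order_polytope r)"
    then obtain x where x: "x \<in> order_polytope r" "y = (\<lambda>i. real k * x i)" and int: "\<And>i. y i \<in> \<int>"
      by (auto simp: lattice_points_dilate_def)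
    have "0 \<le> x i" for i using x(1) by (cases "i \<in> Field r") (auto simp: order_polytope_def)
    then have y0: "0 \<le> y i" for i by (simp add: x(2))
    have yk: "y i \<le> k" if "i \<in> Field r" for i
      using x(1) that by (simp add: x(2) order_polytope_def mult_left_le)
    have mono: "y i \<le> y j" if "(i, j) \<in> r" for i j
      using x(1) that assms by (auto simp: x(2) order_polytope_def)
    define f where "f i = nat \<lfloor>y i\<rfloor>" for i
    have yf: "real (f i) = y i" for i
      using int[of i] y0[of i] by (auto simp: f_def Ints_def)
    have "f i = 0" if "i \<notin> Field r" for i
      using x(1) that by (simp add: f_def x(2) order_polytope_def)
    moreover have "f i \<le> k" if "i \<in> Field r" for i using yk[OF that] yf[of i] by linarith
    moreover have "f i \<le> f j" if "(i, j) \<in> r" for i j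
      using mono[OF that] yf[of i] yf[of j] by linarith
    ultimately have "f \<in> order_maps r k" by (auto simp: order_maps_def)
    then show "y \<in> (\<lambda>f i. real (f i)) ` order_maps r k" using yf by (intro image_eqI[of _ _ f] ext) simp_all
  qed
  then show ?thesis by (simp add: bij_betw_same_card)
qed

text \<open>The value \<open>1\<close> that the Ehrhart series prescribes at \<open>k = 0\<close> agrees with the count of
  order-preserving maps into \<open>{0}\<close>, so the series is the sum of the series of all linear extensions.
  The definite description is resolved because \<open>(1 - t)^(d + 1)\<close> is a unit.\<close>
lemma h_star_order_polytope:
  assumes fin: "finite (Field r)" and nat: "natural_labeling r \<omega>"
  shows "h_star (card (Field r)) (order_polytope r) =
     (\<Sum>xs \<in> linear_extensions r. monom 1 (des (map \<omega> xs)))"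
proof -
  let ?d = "card (Field r)"
  define h :: "real poly" where "h = (\<Sum>xs \<in> linear_extensions r. monom 1 (des (map \<omega> xs)))"
  have inj: "inj_on \<omega> (Field r)" using nat by (simp add: natural_labeling_def labeling_def)
  have len: "length xs = ?d" if "xs \<in> linear_extensions r" for xs
    using that by (metis distinct_card linear_extensions_iff)
  have card: "card (order_maps r k) = (\<Sum>xs \<in> linear_extensions r. card (sorted_maps \<omega> xs k))" for k
    unfolding order_maps_eq_UN_sorted_maps[OF fin nat]
    by (rule card_UN_disjoint)
       (auto simp: finite_linear_extensions fin finite_sorted_maps linear_extensions_iff
         dest: sorted_maps_determine_list)
  have "order_maps r 0 = {\<lambda>_. 0}"
    by (auto simp: order_maps_def)
  then have "ehrhart_series (order_polytope r) = Abs_fps (\<lambda>k. real (card (order_maps r k)))"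
    unfolding ehrhart_series_def
    by (intro fps_ext) (simp add: card_lattice_points_order_polytope)
  also have "\<dots> = (\<Sum>xs \<in> linear_extensions r. Abs_fps (\<lambda>k. real (card (sorted_maps \<omega> xs k))))"
    by (rule fps_ext) (simp add: card fps_sum_nth)
  finally have "ehrhart_series (order_polytope r) * (1 - fps_X) ^ (?d + 1) =
      (\<Sum>xs \<in> linear_extensions r.
         Abs_fps (\<lambda>k. real (card (sorted_maps \<omega> xs k))) * (1 - fps_X) ^ (?d + 1))"
    by (simp only: sum_distrib_right)
  also have "\<dots> = (\<Sum>xs \<in> linear_extensions r. fps_X ^ des (map \<omega> xs))"
  proof (rule sum.cong[OF refl])
    fix xs assume xs: "xs \<in> linear_extensions r"
    then show "Abs_fps (\<lambda>k. real (card (sorted_maps \<omega> xs k))) * (1 - fps_X) ^ (?d + 1) =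
        fps_X ^ des (map \<omega> xs)"
      using sorted_maps_series[of xs \<omega>] inj len[OF xs] by (simp add: linear_extensions_iff)
  qed
  also have "\<dots> = fps_of_poly h"
    by (simp add: h_def fps_of_poly_sum fps_of_poly_monom)
  finally have E: "ehrhart_series (order_polytope r) * (1 - fps_X) ^ (?d + 1) = fps_of_poly h" .
  have nz: "((1 - fps_X) ^ (?d + 1) :: real fps) $ 0 \<noteq> 0" by (simp add: fps_power_zeroth)
  have char: "ehrhart_series (order_polytope r) = fps_of_poly g / (1 - fps_X) ^ (?d + 1) \<longleftrightarrow>
      g = h" for g
  proof -
    have unit: "is_unit ((1 - fps_X) ^ (?d + 1) :: real fps)" using nz fps_is_unit_iff by blast
    have "ehrhart_series (order_polytope r) = fps_of_poly g / (1 - fps_X) ^ (?d + 1) \<longleftrightarrow>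
        ehrhart_series (order_polytope r) * (1 - fps_X) ^ (?d + 1) = fps_of_poly g"
      by (rule unit_eq_div2[OF unit])
    also have "\<dots> \<longleftrightarrow> g = h" unfolding E by (auto simp: fps_of_poly_eq_iff)
    finally show ?thesis .
  qed
  have deg: "degree h \<le> ?d" unfolding h_def
  proof (rule degree_sum_le[OF finite_linear_extensions[OF fin]])
    fix xs assume xs: "xs \<in> linear_extensions r"
    show "degree (monom (1 :: real) (des (map \<omega> xs))) \<le> ?d"
      using des_le_length[of "map \<omega> xs"] len[OF xs] by (simp add: degree_monom_eq)
  qed
  show ?thesis unfolding h_star_def char h_def[symmetric] using deg by blast
qed

section \<open>Exchanging the two runs around a letter\<close>

definition smaller_left :: "'a::linorder list \<Rightarrow> 'a \<Rightarrow> bool" where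
  "smaller_left w y \<longleftrightarrow> (\<exists>u v. w = u @ y # v \<and> u \<noteq> [] \<and> last u < y)"

definition smaller_right :: "'a::linorder list \<Rightarrow> 'a \<Rightarrow> bool" where
  "smaller_right w y \<longleftrightarrow> (\<exists>u v. w = u @ y # v \<and> v \<noteq> [] \<and> hd v < y)"

lemma smaller_left_iff:
  assumes "distinct (u @ y # v)"
  shows "smaller_left (u @ y # v) y \<longleftrightarrow> u \<noteq> [] \<and> last u < y"
  using assms by (auto simp: smaller_left_def append_Cons_eq_iff)

lemma smaller_right_iff:
  assumes "distinct (u @ y # v)"
  shows "smaller_right (u @ y # v) y \<longleftrightarrow> v \<noteq> [] \<and> hd v < y"
  using assms by (auto simp: smaller_right_def append_Cons_eq_iff)

text \<open>\<open>L\<close> and \<open>R\<close> are the maximal runs next to \<open>x\<close> in the word \<open>A @ L @ x # R @ B\<close>, of smaller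
  letters in the first case and of larger letters in the second. A border on the left without a
  letter is allowed only in the first case: the empty border counts as larger than every letter,
  which matches a first letter having no smaller letter on its left.\<close>
definition runs_around :: "'a::linorder list \<Rightarrow> 'a list \<Rightarrow> 'a \<Rightarrow> 'a list \<Rightarrow> 'a list \<Rightarrow> bool" where
  "runs_around A L x R B \<longleftrightarrow>
     (A = [] \<or> x < last A) \<and> x < hd B \<and> (\<forall>z \<in> set L \<union> set R. z < x) \<or>
     A \<noteq> [] \<and> last A < x \<and> hd B < x \<and> (\<forall>z \<in> set L \<union> set R. x < z)"

text \<open>Only neighbours at the ends of \<open>A\<close>, \<open>L\<close>, \<open>R\<close> and \<open>B\<close> change. The letter \<open>x\<close> and the
  letters of both runs lie on the same side of the two border letters, and \<open>x\<close> lies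
  on the same side of every run letter as the border letters do, so each changed neighbour is
  replaced by one that compares in the same way.\<close>
lemma swap_runs_keeps_sides:
  assumes D: "distinct (A @ L @ x # R @ B)" and B: "B \<noteq> []"
    and "runs_around A L x R B"
    and y: "y \<in> set (A @ L @ R @ B)"
  shows "smaller_left (A @ R @ x # L @ B) y = smaller_left (A @ L @ x # R @ B) y"
    and "smaller_right (A @ R @ x # L @ B) y = smaller_right (A @ L @ x # R @ B) y"
proof -
  note runs = \<open>runs_around A L x R B\<close>[unfolded runs_around_def]
  let ?w = "A @ L @ x # R @ B" and ?w' = "A @ R @ x # L @ B"
  have D': "distinct ?w'" using D by auto
  \<comment> \<open>It suffices to compare the neighbours of \<open>y\<close> in any two splittings of the words at \<open>y\<close>.\<close>
  have mv: "smaller_left ?w' y = smaller_left ?w y \<and> smaller_right ?w' y = smaller_right ?w y"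
    if "?w = u @ y # v" "?w' = u' @ y # v'"
      "(u' \<noteq> [] \<and> last u' < y) = (u \<noteq> [] \<and> last u < y)"
      "(v' \<noteq> [] \<and> hd v' < y) = (v \<noteq> [] \<and> hd v < y)" for u v u' v'
    using that smaller_left_iff[of u y v] smaller_left_iff[of u' y v']
      smaller_right_iff[of u y v] smaller_right_iff[of u' y v'] D D' by simp
  from y consider "y \<in> set A" | "y \<in> set L" | "y \<in> set R" | "y \<in> set B" by auto
  then have "smaller_left ?w' y = smaller_left ?w y \<and> smaller_right ?w' y = smaller_right ?w y"
  proof cases
    case 1
    then obtain a b where A: "A = a @ y # b" by (meson split_list)
    show ?thesis
    proof (rule mv[of a "b @ L @ x # R @ B" a "b @ R @ x # L @ B"])
      show "(b @ R @ x # L @ B \<noteq> [] \<and> hd (b @ R @ x # L @ B) < y) =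
        (b @ L @ x # R @ B \<noteq> [] \<and> hd (b @ L @ x # R @ B) < y)"
        using runs A by (cases b; cases L; cases R) auto
    qed (simp_all add: A)
  next
    case 2
    then obtain a b where L: "L = a @ y # b" by (meson split_list)
    show ?thesis
    proof (rule mv[of "A @ a" "b @ x # R @ B" "A @ R @ x # a" "b @ B"])
      show "(A @ R @ x # a \<noteq> [] \<and> last (A @ R @ x # a) < y) =
        (A @ a \<noteq> [] \<and> last (A @ a) < y)"
        using runs by (cases a rule: rev_cases; cases A rule: rev_cases) (auto simp: L)
      show "(b @ B \<noteq> [] \<and> hd (b @ B) < y) = (b @ x # R @ B \<noteq> [] \<and> hd (b @ x # R @ B) < y)"
        using runs B by (cases b) (auto simp: L)
    qed (simp_all add: L)
  next
    case 3
    then obtain a b where R: "R = a @ y # b" by (meson split_list)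
    show ?thesis
    proof (rule mv[of "A @ L @ x # a" "b @ B" "A @ a" "b @ x # L @ B"])
      show "(A @ a \<noteq> [] \<and> last (A @ a) < y) =
        (A @ L @ x # a \<noteq> [] \<and> last (A @ L @ x # a) < y)"
        using runs by (cases a rule: rev_cases; cases A rule: rev_cases) (auto simp: R)
      show "(b @ x # L @ B \<noteq> [] \<and> hd (b @ x # L @ B) < y) = (b @ B \<noteq> [] \<and> hd (b @ B) < y)"
        using runs B by (cases b) (auto simp: R)
    qed (simp_all add: R)
  next
    case 4
    then obtain a b where Bab: "B = a @ y # b" by (meson split_list)
    show ?thesis
    proof (rule mv[of "A @ L @ x # R @ a" b "A @ R @ x # L @ a" b])
      show "(A @ R @ x # L @ a \<noteq> [] \<and> last (A @ R @ x # L @ a) < y) =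
        (A @ L @ x # R @ a \<noteq> [] \<and> last (A @ L @ x # R @ a) < y)"
        using runs Bab by (cases a; cases L rule: rev_cases; cases R rule: rev_cases) auto
    qed (simp_all add: Bab)
  qed
  then show "smaller_left ?w' y = smaller_left ?w y" "smaller_right ?w' y = smaller_right ?w y"
    by simp_all
qed

text \<open>In the case of smaller runs, \<open>x\<close> has a smaller left neighbour exactly if \<open>L\<close> is nonempty,
  and a smaller right neighbour exactly if \<open>R\<close> is; for larger runs, exactly if \<open>L\<close>,
  respectively \<open>R\<close>, is empty.\<close>
lemma swap_runs_exchanges_sides:
  assumes D: "distinct (A @ L @ x # R @ B)" and B: "B \<noteq> []"
    and "runs_around A L x R B"
  shows "smaller_left (A @ R @ x # L @ B) x = smaller_right (A @ L @ x # R @ B) x"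
    and "smaller_right (A @ R @ x # L @ B) x = smaller_left (A @ L @ x # R @ B) x"
proof -
  note runs = \<open>runs_around A L x R B\<close>[unfolded runs_around_def]
  have D': "distinct (A @ R @ x # L @ B)" using D by auto
  have side: "(last Q < x) = (hd Q < x)" if "Q = L \<or> Q = R" "Q \<noteq> []" for Q
    using runs that hd_in_set[of Q] last_in_set[of Q] by (metis UnI1 UnI2 order.asym)
  show "smaller_left (A @ R @ x # L @ B) x = smaller_right (A @ L @ x # R @ B) x"
    using smaller_left_iff[of "A @ R" x "L @ B"] smaller_right_iff[of "A @ L" x "R @ B"] D D' runs B
      side[of R] by (cases "R = []") auto
  show "smaller_right (A @ R @ x # L @ B) x = smaller_left (A @ L @ x # R @ B) x"
    using smaller_left_iff[of "A @ L" x "R @ B"] smaller_right_iff[of "A @ R" x "L @ B"] D D' runs B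
      side[of L] by (cases "L = []") auto
qed

text \<open>The involution on words, as a function: \<open>u\<close> is the part before \<open>x\<close> read backwards, so that
  both runs are initial segments.\<close>
definition swap_runs :: "('a \<Rightarrow> bool) \<Rightarrow> 'a \<Rightarrow> 'a list \<Rightarrow> 'a list" where
  "swap_runs J x w =
     (let u = rev (takeWhile (\<lambda>y. y \<noteq> x) w); v = tl (dropWhile (\<lambda>y. y \<noteq> x) w)
      in rev (dropWhile J u) @ takeWhile J v @ x # rev (takeWhile J u) @ dropWhile J v)"

lemma swap_runs_eq:
  assumes "x \<notin> set A" "x \<notin> set L" "\<forall>z \<in> set L \<union> set R. J z"
    "A = [] \<or> \<not> J (last A)" "B = [] \<or> \<not> J (hd B)"
  shows "swap_runs J x (A @ L @ x # R @ B) = A @ R @ x # L @ B"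
proof -
  have w: "takeWhile (\<lambda>y. y \<noteq> x) (A @ L @ x # R @ B) = A @ L"
    "dropWhile (\<lambda>y. y \<noteq> x) (A @ L @ x # R @ B) = x # R @ B"
    using assms(1,2) by (auto simp: takeWhile_append dropWhile_append)
  have R: "takeWhile J (R @ B) = R" "dropWhile J (R @ B) = B"
    using assms(3,5) by (cases B; auto simp: takeWhile_append dropWhile_append)+
  have L: "takeWhile J (rev L @ rev A) = rev L" "dropWhile J (rev L @ rev A) = rev A"
    using assms(3,4) by (cases A rule: rev_cases; auto simp: takeWhile_append dropWhile_append)+
  show ?thesis by (simp add: swap_runs_def w R L Let_def)
qed

lemma maximal_runs_split:
  assumes "x \<in> set w"
  obtains A L R B where "w = A @ L @ x # R @ B" "\<forall>z \<in> set L \<union> set R. J z"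
    "A = [] \<or> \<not> J (last A)" "B = [] \<or> \<not> J (hd B)"
proof -
  obtain u v where w: "w = u @ x # v" using assms by (meson split_list)
  define A L where "A = rev (dropWhile J (rev u))" and "L = rev (takeWhile J (rev u))"
  have "u = A @ L" unfolding A_def L_def by (metis rev_append rev_rev_ident takeWhile_dropWhile_id)
  then have "w = A @ L @ x # takeWhile J v @ dropWhile J v" by (simp add: w)
  moreover have "A = [] \<or> \<not> J (last A)"
    unfolding A_def last_rev by (metis hd_dropWhile rev_is_Nil_conv)
  moreover have "dropWhile J v = [] \<or> \<not> J (hd (dropWhile J v))" by (metis hd_dropWhile)
  moreover have "\<forall>z \<in> set L \<union> set (takeWhile J v). J z"
    by (auto simp: L_def dest: set_takeWhileD)
  ultimately show thesis using that by blast
qed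

text \<open>Involutions \<open>\<phi> x\<close> that exchange the two bits at \<open>x\<close> and keep all other bits make the two
  bits at each single place exchangeable, independently of the other places. The places are
  symmetrized one after the other; the weight \<open>g\<close> carries the factors of the places that are not
  being treated, which the current involution does not change. The factors \<open>2\<close> avoid
  division, so that the identity is available for polynomials.\<close>
lemma sum_prod_symmetrize:
  fixes f :: "bool \<times> bool \<Rightarrow> 'c::comm_ring_1" and p :: "'v \<Rightarrow> 'x \<Rightarrow> bool \<times> bool"
  assumes "finite T"
    and "\<And>x v. x \<in> T \<Longrightarrow> v \<in> V \<Longrightarrow> \<phi> x v \<in> V \<and> \<phi> x (\<phi> x v) = v"
    and "\<And>x v. x \<in> T \<Longrightarrow> v \<in> V \<Longrightarrow> p (\<phi> x v) x = prod.swap (p v x)"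
    and "\<And>x y v. x \<in> T \<Longrightarrow> y \<in> T \<Longrightarrow> y \<noteq> x \<Longrightarrow> v \<in> V \<Longrightarrow> p (\<phi> x v) y = p v y"
    and "\<And>x v. x \<in> T \<Longrightarrow> v \<in> V \<Longrightarrow> g (\<phi> x v) = g v"
  shows "(\<Sum>v\<in>V. g v * (\<Prod>x\<in>T. 2 * f (p v x))) =
         (\<Sum>v\<in>V. g v * (\<Prod>x\<in>T. f (p v x) + f (prod.swap (p v x))))"
  using assms
proof (induction T arbitrary: g rule: finite_induct)
  case (insert x T)
  \<comment> \<open>The weight left over once the places in \<open>T\<close> are symmetrized; it is invariant under \<open>\<phi> x\<close>.\<close>
  define h where "h v = g v * (\<Prod>y\<in>T. f (p v y) + f (prod.swap (p v y)))" for v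
  have inv: "h (\<phi> x v) = h v" if "v \<in> V" for v
  proof -
    have "(\<Prod>y\<in>T. f (p (\<phi> x v) y) + f (prod.swap (p (\<phi> x v) y))) =
        (\<Prod>y\<in>T. f (p v y) + f (prod.swap (p v y)))"
    proof (rule prod.cong[OF refl])
      fix y assume y: "y \<in> T"
      then have "y \<noteq> x" using insert.hyps by auto
      then show "f (p (\<phi> x v) y) + f (prod.swap (p (\<phi> x v) y)) = f (p v y) + f (prod.swap (p v y))"
        using insert.prems(3)[of x y v] y that by simp
    qed
    then show ?thesis using insert.prems(4) that by (simp add: h_def)
  qed
  have "(\<Sum>v\<in>V. g v * (\<Prod>y\<in>insert x T. 2 * f (p v y))) =
      (\<Sum>v\<in>V. (g v * (2 * f (p v x))) * (\<Prod>y\<in>T. 2 * f (p v y)))"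
    using insert.hyps by (simp add: mult_ac)
  also have "\<dots> = (\<Sum>v\<in>V. (g v * (2 * f (p v x))) * (\<Prod>y\<in>T. f (p v y) + f (prod.swap (p v y))))"
  proof (rule insert.IH)
    fix y v assume yv: "y \<in> T" "v \<in> V"
    then have "x \<noteq> y" using insert.hyps by auto
    then show "g (\<phi> y v) * (2 * f (p (\<phi> y v) x)) = g v * (2 * f (p v x))"
      using insert.prems(3)[of y x v] insert.prems(4)[of y v] yv by simp
  qed (use insert.prems in auto)
  also have "\<dots> = (\<Sum>v\<in>V. h v * f (p v x)) + (\<Sum>v\<in>V. h v * f (p v x))"
    by (simp add: h_def sum.distrib[symmetric] algebra_simps)
  finally have *: "(\<Sum>v\<in>V. g v * (\<Prod>y\<in>insert x T. 2 * f (p v y))) =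
      (\<Sum>v\<in>V. h v * f (p v x)) + (\<Sum>v\<in>V. h v * f (p v x))" .
  have "(\<Sum>v\<in>V. h v * f (p v x)) = (\<Sum>v\<in>V. h (\<phi> x v) * f (p (\<phi> x v) x))"
    by (rule sum.reindex_bij_witness[of _ "\<phi> x" "\<phi> x"]) (use insert.prems(1) in auto)
  also have "\<dots> = (\<Sum>v\<in>V. h v * f (prod.swap (p v x)))"
    by (intro sum.cong refl) (use inv insert.prems(2) in auto)
  finally have "(\<Sum>v\<in>V. h v * f (p v x)) = (\<Sum>v\<in>V. h v * f (prod.swap (p v x)))" .
  moreover have "(\<Sum>v\<in>V. h v * f (p v x)) + (\<Sum>v\<in>V. h v * f (prod.swap (p v x))) =
      (\<Sum>v\<in>V. g v * (\<Prod>y\<in>insert x T. f (p v y) + f (prod.swap (p v y))))"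
    using insert.hyps by (simp add: h_def sum.distrib[symmetric] algebra_simps)
  ultimately show ?case using * by simp
qed simp

section \<open>Descents and peaks as statistics of letters\<close>

lemma smaller_left_nth:
  assumes "distinct w" "i < length w"
  shows "smaller_left w (w ! i) \<longleftrightarrow> 0 < i \<and> w ! (i - 1) < w ! i"
proof -
  have "w = take i w @ w ! i # drop (Suc i) w" using assms(2) by (rule id_take_nth_drop)
  then have "smaller_left w (w ! i) \<longleftrightarrow> take i w \<noteq> [] \<and> last (take i w) < w ! i"
    using smaller_left_iff[of "take i w" "w ! i" "drop (Suc i) w"] assms(1) by simp
  then show ?thesis using assms(2) by (cases i) (auto simp: take_Suc_conv_app_nth Suc_lessD)
qed

lemma smaller_right_nth:
  assumes "distinct w" "i < length w"
  shows "smaller_right w (w ! i) \<longleftrightarrow> i + 1 < length w \<and> w ! (i + 1) < w ! i"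
proof -
  have "w = take i w @ w ! i # drop (Suc i) w" using assms(2) by (rule id_take_nth_drop)
  then have "smaller_right w (w ! i) \<longleftrightarrow> drop (Suc i) w \<noteq> [] \<and> hd (drop (Suc i) w) < w ! i"
    using smaller_right_iff[of "take i w" "w ! i" "drop (Suc i) w"] assms(1) by simp
  then show ?thesis by (auto simp: hd_drop_conv_nth)
qed

lemma card_letters_eq_card_positions:
  assumes "distinct w"
  shows "card {y \<in> set w. P y} = card {i. i < length w \<and> P (w ! i)}"
proof -
  have "{y \<in> set w. P y} = (!) w ` {i. i < length w \<and> P (w ! i)}"
    by (auto simp: in_set_conv_nth)
  moreover have "inj_on ((!) w) {i. i < length w \<and> P (w ! i)}"
    using assms by (auto simp: inj_on_def nth_eq_iff_index_eq)
  ultimately show ?thesis by (simp add: card_image)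
qed

lemma des_eq_card_letters:
  assumes "distinct w"
  shows "des w = card {y \<in> set w. smaller_right w y}"
  unfolding card_letters_eq_card_positions[OF assms] des_def
  by (intro arg_cong[where f = card] Collect_cong) (use smaller_right_nth[OF assms] in auto)

lemma peak_eq_card_letters:
  assumes "distinct w"
  shows "peak w = card {y \<in> set w. smaller_left w y \<and> smaller_right w y}"
  unfolding card_letters_eq_card_positions[OF assms] peak_def
  by (intro arg_cong[where f = card] Collect_cong)
     (use smaller_right_nth[OF assms] smaller_left_nth[OF assms] in auto)

text \<open>Each of the \<open>length w - 1\<close> adjacent pairs is either an ascent, counted at its second letter, or
  a descent, counted at its first.\<close>
lemma card_smaller_neighbours:
  assumes D: "distinct w" and "w \<noteq> []"
  shows "card {y \<in> set w. smaller_left w y} + card {y \<in> set w. smaller_right w y} = length w - 1"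
proof -
  let ?A = "{i. i + 1 < length w \<and> w ! i < w ! (i + 1)}"
  let ?D = "{i. i + 1 < length w \<and> w ! (i + 1) < w ! i}"
  have "{i. i < length w \<and> smaller_left w (w ! i)} = Suc ` ?A"
  proof (intro set_eqI iffI)
    fix i assume "i \<in> {i. i < length w \<and> smaller_left w (w ! i)}"
    then show "i \<in> Suc ` ?A" using smaller_left_nth[OF D, of i] by (cases i) auto
  next
    fix i assume "i \<in> Suc ` ?A"
    then show "i \<in> {i. i < length w \<and> smaller_left w (w ! i)}"
      using smaller_left_nth[OF D, of i] by auto
  qed
  then have A: "card {y \<in> set w. smaller_left w y} = card ?A"
    unfolding card_letters_eq_card_positions[OF D] by (simp add: card_image)
  have B: "card {y \<in> set w. smaller_right w y} = card ?D"
    using des_eq_card_letters[OF D] by (simp add: des_def)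
  have "?A \<union> ?D = {..<length w - 1}"
  proof (rule set_eqI)
    fix i
    have "w ! i \<noteq> w ! (i + 1)" if "i + 1 < length w"
      using D that by (simp add: nth_eq_iff_index_eq)
    then show "i \<in> ?A \<union> ?D \<longleftrightarrow> i \<in> {..<length w - 1}" by (auto simp: neq_iff)
  qed
  moreover have "card (?A \<union> ?D) = card ?A + card ?D"
    by (rule card_Un_disjoint) (auto intro: finite_subset[of _ "{..<length w}"])
  ultimately show ?thesis unfolding A B by simp
qed

section \<open>Words of two-level posets\<close>

text \<open>A nonempty finite poset in which every element is minimal or maximal and none is both;
  \<open>hi\<close> marks the maximal elements.\<close>
locale two_level_poset =
  fixes r :: "'a rel" and hi :: "'a \<Rightarrow> bool"
  assumes finite_Field: "finite (Field r)" and Field_nonempty: "Field r \<noteq> {}"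
    and levels: "\<And>x y. (x, y) \<in> r \<Longrightarrow> x \<noteq> y \<Longrightarrow> \<not> hi x \<and> hi y"
    and above: "\<And>x. x \<in> Field r \<Longrightarrow> \<not> hi x \<Longrightarrow> \<exists>y. hi y \<and> (x, y) \<in> r"
    and below: "\<And>y. y \<in> Field r \<Longrightarrow> hi y \<Longrightarrow> \<exists>x. \<not> hi x \<and> (x, y) \<in> r"
begin

lemma linear_extension_nonempty: "xs \<in> linear_extensions r \<Longrightarrow> xs \<noteq> []"
  using Field_nonempty by (auto simp: linear_extensions_iff)

lemma hd_linear_extension:
  assumes "xs \<in> linear_extensions r"
  shows "\<not> hi (hd xs)"
proof
  assume h: "hi (hd xs)"
  obtain a as where xs: "xs = a # as" using linear_extension_nonempty[OF assms] by (cases xs) auto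
  then have "a \<in> Field r" using assms by (auto simp: linear_extensions_iff)
  then obtain x where x: "\<not> hi x" "(x, a) \<in> r" using below h xs by auto
  then have "x \<in> Field r" "x \<noteq> a" using h xs by (auto intro: FieldI1)
  then have "x \<in> set as" using assms xs by (auto simp: linear_extensions_iff)
  then show False using assms xs x(2) by (auto simp: linear_extensions_iff)
qed

lemma last_linear_extension:
  assumes "xs \<in> linear_extensions r"
  shows "hi (last xs)"
proof (rule ccontr)
  assume h: "\<not> hi (last xs)"
  obtain a as where xs: "xs = as @ [a]"
    using linear_extension_nonempty[OF assms] by (cases xs rule: rev_cases) auto
  then have "a \<in> Field r" using assms by (auto simp: linear_extensions_iff)
  then obtain y where y: "hi y" "(a, y) \<in> r" using above h xs by auto
  then have "y \<in> Field r" "y \<noteq> a" using h xs by (auto intro: FieldI2)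
  then have "y \<in> set as" using assms xs by (auto simp: linear_extensions_iff)
  then show False using assms xs y(2) by (auto simp: linear_extensions_iff sorted_wrt_append)
qed

end

lemma two_power_split:
  assumes "2 * i \<le> d"
  shows "(2 :: 'c::comm_ring_1) ^ d = 2 ^ (d - 2 * i) * 4 ^ i"
proof -
  have "(2 :: 'c) ^ (d - 2 * i + 2 * i) = 2 ^ (d - 2 * i) * (2 ^ 2) ^ i"
    by (simp only: power_add power_mult)
  then show ?thesis using assms by simp
qed

text \<open>\<open>l\<close> labels the poset and \<open>c\<close> the adjoined greatest element. Canonical labelings are of this
  kind; the labels on each level are in arbitrary order, and so is \<open>c\<close> relative to the lower level.\<close>
locale separated_labeling = two_level_poset +
  fixes l :: "'a \<Rightarrow> int" and c :: int
  assumes inj_l: "inj_on l (Field r)" and c_fresh: "c \<notin> l ` Field r"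
    and lo_less_hi: "\<And>x y. x \<in> Field r \<Longrightarrow> y \<in> Field r \<Longrightarrow> \<not> hi x \<Longrightarrow> hi y \<Longrightarrow> l x < l y"
    and c_less_hi: "\<And>y. y \<in> Field r \<Longrightarrow> hi y \<Longrightarrow> c < l y"
begin

definition word :: "'a list \<Rightarrow> int list" where
  "word xs = map l xs @ [c]"

definition sides :: "'a list \<Rightarrow> 'a \<Rightarrow> bool \<times> bool" where
  "sides xs x = (smaller_left (word xs) (l x), smaller_right (word xs) (l x))"

definition jumps :: "'a \<Rightarrow> 'a \<Rightarrow> bool" where
  "jumps x z \<longleftrightarrow> (if hi x then l x < l z else l z < l x)"

lemma natural_labeling_l: "natural_labeling r l"
proof -
  have "l x \<le> l y" if "(x, y) \<in> r" for x y
    using that levels[of x y] lo_less_hi[of x y]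
    by (cases "x = y") (auto simp: Field_def intro: less_imp_le)
  then show ?thesis using inj_l by (auto simp: natural_labeling_def labeling_def)
qed

lemma distinct_word: "xs \<in> linear_extensions r \<Longrightarrow> distinct (word xs)"
  using inj_l c_fresh by (auto simp: word_def linear_extensions_iff distinct_map)

lemma inj_on_word: "inj_on word (linear_extensions r)"
  using inj_l by (auto simp: inj_on_def word_def linear_extensions_iff intro: map_inj_on)

text \<open>Maximal runs satisfy the border conditions: a linear extension starts on the lower and ends
  on the upper level. Hence a run of smaller letters around a lower letter is stopped on the right by an
  upper one before \<open>c\<close> is reached, and a run of larger letters around an upper letter is
  stopped on the left by a lower one, and on the right at the latest by \<open>c\<close>.\<close>
lemma linear_extension_split:
  assumes xs: "xs \<in> linear_extensions r" and x: "x \<in> Field r"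
  obtains A L R B where "xs = A @ L @ x # R @ B"
    "swap_runs (jumps x) x xs = A @ R @ x # L @ B"
    "swap_runs (jumps x) x (A @ R @ x # L @ B) = xs"
    "\<forall>z \<in> set L \<union> set R. hi z = hi x"
    "runs_around (map l A) (map l L) (l x) (map l R) (map l B @ [c])"
proof -
  have dist: "distinct xs" and set: "set xs = Field r" using xs by (auto simp: linear_extensions_iff)
  obtain A L R B where eq: "xs = A @ L @ x # R @ B" and J: "\<forall>z \<in> set L \<union> set R. jumps x z"
    and A: "A = [] \<or> \<not> jumps x (last A)" and B: "B = [] \<or> \<not> jumps x (hd B)"
    by (rule maximal_runs_split[of x xs "jumps x"]) (use x set in auto)
  have F: "set A \<union> set L \<union> set R \<union> set B \<subseteq> Field r" using eq set by auto
  have hiJ: "\<forall>z \<in> set L \<union> set R. hi z = hi x"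
  proof
    fix z assume z: "z \<in> set L \<union> set R"
    then have "z \<in> Field r" using F by auto
    moreover have "if hi x then l x < l z else l z < l x" using J z jumps_def by blast
    ultimately show "hi z = hi x"
      using x lo_less_hi[of x z] lo_less_hi[of z x] by (auto split: if_splits)
  qed
  have ne: "l z \<noteq> l x" if "z \<in> set A \<union> set B" for z
  proof -
    have "z \<noteq> x" "z \<in> Field r" using that dist eq F by auto
    then show ?thesis using inj_l x by (auto dest: inj_onD)
  qed
  have "runs_around (map l A) (map l L) (l x) (map l R) (map l B @ [c])"
  proof (cases "hi x")
    case True
    have "A \<noteq> []"
    proof
      assume "A = []"
      then have "hd xs \<in> set L \<union> {x}" using eq by (cases L) auto
      then show False using hd_linear_extension[OF xs] hiJ True by auto
    qed
    moreover have "l (last A) < l x"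
      using A ne[of "last A"] \<open>A \<noteq> []\<close> True by (auto simp: jumps_def)
    moreover have "hd (map l B @ [c]) < l x"
      using B ne[of "hd B"] c_less_hi[OF x True] True by (cases B) (auto simp: jumps_def)
    ultimately show ?thesis using J True by (auto simp: runs_around_def jumps_def last_map)
  next
    case False
    have "B \<noteq> []"
    proof
      assume "B = []"
      then have "last xs \<in> set R \<union> {x}" using eq by (cases R rule: rev_cases) auto
      then show False using last_linear_extension[OF xs] hiJ False by auto
    qed
    then have "l x < hd (map l B @ [c])"
      using B ne[of "hd B"] False by (cases B) (auto simp: jumps_def)
    moreover have "A = [] \<or> l x < l (last A)"
      using A ne[of "last A"] False by (cases "A = []") (auto simp: jumps_def)
    ultimately show ?thesis using J False by (auto simp: runs_around_def jumps_def last_map)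
  qed
  moreover have "swap_runs (jumps x) x xs = A @ R @ x # L @ B"
    unfolding eq using dist J A B by (intro swap_runs_eq) (auto simp: eq)
  moreover have "swap_runs (jumps x) x (A @ R @ x # L @ B) = xs"
    unfolding eq using dist J A B by (intro swap_runs_eq) (auto simp: eq)
  ultimately show thesis using that eq hiJ by blast
qed

text \<open>The letters that move lie on one level, and elements of one level are incomparable.\<close>
lemma swap_runs_linear_extension:
  assumes xs: "xs \<in> linear_extensions r" and x: "x \<in> Field r"
  defines "xs' \<equiv> swap_runs (jumps x) x xs"
  shows "xs' \<in> linear_extensions r"
    and "swap_runs (jumps x) x xs' = xs"
    and "sides xs' x = prod.swap (sides xs x)"
    and "y \<in> Field r \<Longrightarrow> y \<noteq> x \<Longrightarrow> sides xs' y = sides xs y"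
proof -
  obtain A L R B where eq: "xs = A @ L @ x # R @ B"
    and sw: "swap_runs (jumps x) x xs = A @ R @ x # L @ B"
    and ws: "swap_runs (jumps x) x (A @ R @ x # L @ B) = xs"
    and lev: "\<forall>z \<in> set L \<union> set R. hi z = hi x"
    and runs: "runs_around (map l A) (map l L) (l x) (map l R) (map l B @ [c])"
    using linear_extension_split[OF xs x] by blast
  have xs': "xs' = A @ R @ x # L @ B" by (simp add: xs'_def sw)
  have dist: "distinct xs" and set: "set xs = Field r"
    and srt: "sorted_wrt (\<lambda>x y. (y, x) \<notin> r) xs"
    using xs by (auto simp: linear_extensions_iff)
  have incomparable: "(u, v) \<notin> r" if "u \<noteq> v" "u \<in> set L \<union> set R \<union> {x}" "v \<in> set L \<union> set R \<union> {x}" for u v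
    using levels[of u v] lev that by blast
  show "xs' \<in> linear_extensions r"
    unfolding linear_extensions_iff
  proof (intro conjI)
    show "distinct xs'" using dist by (auto simp: xs' eq)
    show "set xs' = Field r" using set by (auto simp: xs' eq)
    have "\<forall>u \<in> set R. \<forall>v \<in> set L. (v, u) \<notin> r" "\<forall>u \<in> set R. (x, u) \<notin> r" "\<forall>u \<in> set L. (u, x) \<notin> r"
      using dist by (intro ballI incomparable; auto simp: eq)+
    then show "sorted_wrt (\<lambda>x y. (y, x) \<notin> r) xs'"
      using srt by (auto simp: xs' eq sorted_wrt_append)
  qed
  show "swap_runs (jumps x) x xs' = xs" by (simp add: xs' ws)
  have D: "distinct (map l A @ map l L @ l x # map l R @ (map l B @ [c]))"
    using distinct_word[OF xs] by (simp add: word_def eq)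
  have w: "word xs = map l A @ map l L @ l x # map l R @ (map l B @ [c])"
    and w': "word xs' = map l A @ map l R @ l x # map l L @ (map l B @ [c])"
    by (simp_all add: word_def eq xs')
  show "sides xs' x = prod.swap (sides xs x)"
    unfolding sides_def w w' using swap_runs_exchanges_sides[OF D _ runs] by simp
  show "sides xs' y = sides xs y" if "y \<in> Field r" "y \<noteq> x"
  proof -
    have "l y \<in> set (map l A @ map l L @ map l R @ (map l B @ [c]))"
      using that set by (auto simp: eq)
    then show ?thesis
      unfolding sides_def w w' using swap_runs_keeps_sides[OF D _ runs] by simp
  qed
qed

lemma card_word_letters:
  assumes xs: "xs \<in> linear_extensions r" and "\<not> P c"
  shows "card {y \<in> set (word xs). P y} = card {x \<in> Field r. P (l x)}"
proof -
  have "{y \<in> set (word xs). P y} = l ` {x \<in> Field r. P (l x)}"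
    using assms by (auto simp: word_def linear_extensions_iff)
  then show ?thesis using inj_on_subset[OF inj_l, of "{x \<in> Field r. P (l x)}"]
    by (simp add: card_image)
qed

lemma c_less_last:
  assumes "xs \<in> linear_extensions r"
  shows "c < last (map l xs)"
proof -
  have "last xs \<in> Field r"
    using last_in_set[OF linear_extension_nonempty[OF assms]] assms
    by (simp add: linear_extensions_iff)
  then show ?thesis
    using c_less_hi last_linear_extension[OF assms] linear_extension_nonempty[OF assms]
    by (simp add: last_map)
qed

lemma top_is_valley:
  assumes "xs \<in> linear_extensions r"
  shows "\<not> smaller_left (word xs) c" "\<not> smaller_right (word xs) c"
  using smaller_left_iff[of "map l xs" c "[]"] smaller_right_iff[of "map l xs" c "[]"]
    distinct_word[OF assms] c_less_last[OF assms] by (simp_all add: word_def)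

lemma peak_word:
  assumes "xs \<in> linear_extensions r"
  shows "peak (word xs) = card {x \<in> Field r. sides xs x = (True, True)}"
  using card_word_letters[OF assms] top_is_valley[OF assms]
  by (simp add: peak_eq_card_letters[OF distinct_word[OF assms]] sides_def)

lemma des_word:
  assumes "xs \<in> linear_extensions r"
  shows "des (word xs) = peak (word xs) + card {x \<in> Field r. sides xs x = (False, True)}"
proof -
  have "des (word xs) = card {x \<in> Field r. snd (sides xs x)}"
    using card_word_letters[OF assms] top_is_valley[OF assms]
    by (simp add: des_eq_card_letters[OF distinct_word[OF assms]] sides_def)
  also have "{x \<in> Field r. snd (sides xs x)} = {x \<in> Field r. sides xs x = (True, True)} \<union>
      {x \<in> Field r. sides xs x = (False, True)}" by (auto simp: prod_eq_iff)
  also have "card \<dots> = peak (word xs) + card {x \<in> Field r. sides xs x = (False, True)}"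
    unfolding peak_word[OF assms] by (rule card_Un_disjoint) (auto simp: finite_Field)
  finally show ?thesis .
qed

text \<open>Counting smaller left and smaller right neighbours together gives one for every one-sided letter
  and two for every peak, and \<open>d\<close> in total.\<close>
lemma card_one_sided:
  assumes "xs \<in> linear_extensions r"
  shows "card {x \<in> Field r. fst (sides xs x) \<noteq> snd (sides xs x)} + 2 * peak (word xs) =
    card (Field r)"
proof -
  let ?L = "{x \<in> Field r. fst (sides xs x)}" and ?R = "{x \<in> Field r. snd (sides xs x)}"
  have "card ?L + card ?R = length (word xs) - 1"
    using card_smaller_neighbours[OF distinct_word[OF assms]] card_word_letters[OF assms]
      top_is_valley[OF assms] by (simp add: sides_def word_def)
  also have "\<dots> = card (Field r)"
    using assms distinct_card[of xs] by (simp add: word_def linear_extensions_iff)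
  finally have "card ?L + card ?R = card (Field r)" .
  moreover have "card ?L + card ?R = card (?L \<union> ?R) + card (?L \<inter> ?R)"
    by (rule card_Un_Int) (simp_all add: finite_Field)
  moreover have "?L \<inter> ?R = {x \<in> Field r. sides xs x = (True, True)}" by (auto simp: prod_eq_iff)
  moreover have "?L \<union> ?R = {x \<in> Field r. fst (sides xs x) \<noteq> snd (sides xs x)} \<union> ?L \<inter> ?R" by auto
  moreover have "card ({x \<in> Field r. fst (sides xs x) \<noteq> snd (sides xs x)} \<union> ?L \<inter> ?R) =
      card {x \<in> Field r. fst (sides xs x) \<noteq> snd (sides xs x)} + card (?L \<inter> ?R)"
    by (rule card_Un_disjoint) (auto simp: finite_Field)
  ultimately show ?thesis by (simp add: peak_word[OF assms])
qed

text \<open>The largest letter is on the upper level, hence neither the first nor the last letter of the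
  word, and so it is a peak.\<close>
lemma peak_word_pos:
  assumes "xs \<in> linear_extensions r"
  shows "peak (word xs) > 0"
proof -
  have ne: "xs \<noteq> []" by (rule linear_extension_nonempty[OF assms])
  have set: "set xs = Field r" and D: "distinct (map l xs @ [c])"
    using assms distinct_word[OF assms] by (auto simp: linear_extensions_iff word_def)
  define m where "m = Max (l ` set xs)"
  have "m \<in> l ` set xs" unfolding m_def using ne by (intro Max_in) auto
  then obtain x where x: "x \<in> set xs" "m = l x" by auto
  have max: "l y \<le> l x" if "y \<in> set xs" for y
    unfolding x(2)[symmetric] m_def using that by (intro Max_ge) auto
  have less: "l y < l x" if "y \<in> set xs" "y \<noteq> x" for y
    using max[OF that(1)] inj_l that x(1) set by (metis inj_onD order_le_less)
  have hix: "hi x"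
    using less[of "last xs"] last_linear_extension[OF assms] lo_less_hi[of x "last xs"] ne x(1) set
    by (metis last_in_set order.asym)
  obtain u v where uv: "xs = u @ x # v" using x(1) by (meson split_list)
  have "u \<noteq> []" using hd_linear_extension[OF assms] hix uv by (cases u) auto
  have notin: "x \<notin> set u" "x \<notin> set v" using assms uv by (auto simp: linear_extensions_iff)
  have "last (map l u) < l x" using less[of "last u"] notin \<open>u \<noteq> []\<close> uv
    by (auto simp: last_map) (metis last_in_set)
  moreover have "hd (map l v @ [c]) < l x"
    using c_less_hi[of x] hix x(1) set less[of "hd v"] notin uv by (cases v) auto
  ultimately have "sides xs x = (True, True)"
    using smaller_left_iff[of "map l u" "l x" "map l v @ [c]"]
      smaller_right_iff[of "map l u" "l x" "map l v @ [c]"] \<open>u \<noteq> []\<close> D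
    by (simp add: sides_def word_def uv)
  then have "{x \<in> Field r. sides xs x = (True, True)} \<noteq> {}" using x(1) set by auto
  then show ?thesis unfolding peak_word[OF assms] by (simp add: card_gt_0_iff finite_Field)
qed

definition peak_class :: "nat \<Rightarrow> 'a list set" where
  "peak_class i = {xs \<in> linear_extensions r. peak (word xs) = i}"

text \<open>Every peak is a descent, so \<open>des = i\<close> says that the word has no double descent.\<close>
definition gamma :: "nat \<Rightarrow> nat" where
  "gamma i = card {xs \<in> peak_class i. des (word xs) = i}"

lemma finite_peak_class: "finite (peak_class i)"
  by (simp add: peak_class_def finite_linear_extensions finite_Field)

text \<open>The weight of a letter is \<open>u\<close> at a double descent and \<open>1\<close> otherwise. Symmetrization
  turns each of the \<open>d - 2 i\<close> one-sided letters into a factor \<open>1 + u\<close> and each of the other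
  \<open>2 i\<close> letters of the poset into a factor \<open>2\<close>.\<close>
lemma peak_class_symmetrized:
  fixes u :: "'c::comm_ring_1"
  shows "2 ^ card (Field r) * (\<Sum>xs \<in> peak_class i. u ^ (des (word xs) - i)) =
     of_nat (card (peak_class i)) * (4 ^ i * (1 + u) ^ (card (Field r) - 2 * i))"
proof -
  define f :: "bool \<times> bool \<Rightarrow> 'c" where "f s = (if s = (False, True) then u else 1)" for s
  have V: "xs \<in> linear_extensions r" "peak (word xs) = i" if "xs \<in> peak_class i" for xs
    using that by (auto simp: peak_class_def)
  have one: "(\<Prod>x\<in>Field r. 2 * f (sides xs x)) = 2 ^ card (Field r) * u ^ (des (word xs) - i)"
    if "xs \<in> peak_class i" for xs
  proof -
    have "(\<Prod>x\<in>Field r. f (sides xs x)) = u ^ card {x \<in> Field r. sides xs x = (False, True)}"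
      by (simp add: f_def prod.inter_filter[OF finite_Field, symmetric])
    then show ?thesis
      using des_word[OF V(1)[OF that]] V(2)[OF that] by (simp add: prod.distrib)
  qed
  have two: "(\<Prod>x\<in>Field r. f (sides xs x) + f (prod.swap (sides xs x))) =
      4 ^ i * (1 + u) ^ (card (Field r) - 2 * i)" if "xs \<in> peak_class i" for xs
  proof -
    let ?O = "{x \<in> Field r. fst (sides xs x) \<noteq> snd (sides xs x)}"
    let ?E = "{x \<in> Field r. fst (sides xs x) = snd (sides xs x)}"
    have O: "card ?O = card (Field r) - 2 * i"
      using card_one_sided[OF V(1)[OF that]] V(2)[OF that] by simp
    have "card ?O + card ?E = card (?O \<union> ?E)"
      by (rule card_Un_disjoint[symmetric]) (auto simp: finite_Field)
    also have "?O \<union> ?E = Field r" by auto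
    finally have E: "card ?E = 2 * i"
      using card_one_sided[OF V(1)[OF that]] V(2)[OF that] by simp
    have "f s + f (prod.swap s) = (if fst s \<noteq> snd s then 1 + u else 1) * (if fst s = snd s then 2 else 1)"
      for s by (cases s) (auto simp: f_def)
    then have "(\<Prod>x\<in>Field r. f (sides xs x) + f (prod.swap (sides xs x))) =
        (1 + u) ^ card ?O * 2 ^ card ?E"
      by (simp only: prod.distrib prod.inter_filter[OF finite_Field, symmetric] prod_constant)
    moreover have "(2 :: 'c) ^ (2 * i) = 4 ^ i" by (simp add: power_mult)
    ultimately show ?thesis unfolding O E by (simp only: mult.commute)
  qed
  have "(\<Sum>xs \<in> peak_class i. 1 * (\<Prod>x\<in>Field r. 2 * f (sides xs x))) =
      (\<Sum>xs \<in> peak_class i. 1 * (\<Prod>x\<in>Field r. f (sides xs x) + f (prod.swap (sides xs x))))"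
  proof (rule sum_prod_symmetrize[where \<phi> = "\<lambda>x. swap_runs (jumps x) x"])
    fix x xs assume x: "x \<in> Field r" and xs: "xs \<in> peak_class i"
    note V = V[OF xs]
    let ?xs' = "swap_runs (jumps x) x xs"
    note sw = swap_runs_linear_extension[OF V(1) x]
    show "sides ?xs' x = prod.swap (sides xs x)" by (rule sw(3))
    show "sides ?xs' y = sides xs y" if "y \<in> Field r" "y \<noteq> x" for y
      using that by (rule sw(4))
    have "sides ?xs' y = (True, True) \<longleftrightarrow> sides xs y = (True, True)" if "y \<in> Field r" for y
      using sw(3) sw(4)[OF that] by (cases "y = x") (auto simp: prod_eq_iff)
    then have "peak (word ?xs') = peak (word xs)"
      unfolding peak_word[OF V(1)] peak_word[OF sw(1)]
      by (intro arg_cong[where f = card] Collect_cong) auto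
    then show "?xs' \<in> peak_class i \<and> swap_runs (jumps x) x ?xs' = xs"
      using sw(1,2) V(2) by (simp add: peak_class_def)
  qed (simp_all add: finite_Field)
  then show ?thesis by (simp add: one two sum_distrib_left cong: sum.cong)
qed

lemma peak_class_nonempty_bounds:
  assumes "peak_class i \<noteq> {}"
  shows "0 < i" "2 * i \<le> card (Field r)"
  using assms peak_word_pos card_one_sided by (auto simp: peak_class_def) (metis le_add2)

text \<open>The value at \<open>u = 0\<close>, where only words without double descents survive.\<close>
lemma card_peak_class:
  assumes "2 * i \<le> card (Field r)"
  shows "card (peak_class i) = 2 ^ (card (Field r) - 2 * i) * gamma i"
proof -
  have "(\<Sum>xs \<in> peak_class i. (0 :: int) ^ (des (word xs) - i)) =
      (\<Sum>xs \<in> peak_class i. if des (word xs) = i then 1 else 0)"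
  proof (rule sum.cong[OF refl])
    fix xs assume "xs \<in> peak_class i"
    then have "i \<le> des (word xs)" using des_word by (auto simp: peak_class_def)
    then show "(0 :: int) ^ (des (word xs) - i) = (if des (word xs) = i then 1 else 0)"
      by (simp add: power_0_left)
  qed
  also have "\<dots> = int (gamma i)"
    by (simp add: gamma_def sum.inter_filter[OF finite_peak_class, symmetric])
  finally have "2 ^ card (Field r) * int (gamma i) = int (card (peak_class i)) * 4 ^ i"
    using peak_class_symmetrized[of "0 :: int" i] by simp
  also have "(2 :: int) ^ card (Field r) = 2 ^ (card (Field r) - 2 * i) * 4 ^ i"
    by (rule two_power_split[OF assms])
  finally have "int (card (peak_class i)) * 4 ^ i = int (2 ^ (card (Field r) - 2 * i) * gamma i) * 4 ^ i"
    by (simp add: mult_ac)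
  then show ?thesis by (metis mult_right_cancel of_nat_eq_iff power_not_zero zero_neq_numeral)
qed

text \<open>The value at \<open>u = t\<close>; the powers of two cancel against those of the value at \<open>u = 0\<close>.\<close>
lemma peak_class_des_polynomial:
  "(\<Sum>xs \<in> peak_class i. (monom 1 (des (word xs)) :: real poly)) =
     of_nat (gamma i) * (monom 1 i * [:1, 1:] ^ (card (Field r) - 2 * i))"
proof (cases "peak_class i = {}")
  case True
  then show ?thesis by (simp add: gamma_def)
next
  case False
  note i = peak_class_nonempty_bounds(2)[OF False]
  let ?X = "monom 1 1 :: real poly" and ?d = "card (Field r)"
  have X: "monom 1 (des (word xs)) = ?X ^ i * ?X ^ (des (word xs) - i)" if "xs \<in> peak_class i" for xs
    using that des_word[of xs] by (simp add: peak_class_def mult_monom monom_power)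
  have p4: "(2 :: real poly) ^ ?d = 2 ^ (?d - 2 * i) * 4 ^ i"
    by (rule two_power_split[OF i])
  have one: "1 + ?X = [:1, 1:]" by (simp add: monom_altdef one_pCons)
  have "2 ^ ?d * (\<Sum>xs \<in> peak_class i. monom 1 (des (word xs))) =
      ?X ^ i * (2 ^ ?d * (\<Sum>xs \<in> peak_class i. ?X ^ (des (word xs) - i)))"
    by (simp add: X sum_distrib_left mult_ac cong: sum.cong)
  also have "\<dots> = ?X ^ i * (of_nat (card (peak_class i)) * (4 ^ i * [:1, 1:] ^ (?d - 2 * i)))"
    unfolding peak_class_symmetrized one ..
  also have "\<dots> = 2 ^ ?d * (of_nat (gamma i) * (?X ^ i * [:1, 1:] ^ (?d - 2 * i)))"
    unfolding card_peak_class[OF i] p4 by (simp add: mult_ac)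
  finally show ?thesis by (simp add: monom_power)
qed

text \<open>The letter \<open>c\<close> at the end contributes one descent to each word, and each word has at least one
  peak. So the factor \<open>t\<close> cancels, and the number of peaks is shifted by one against the
  exponent \<open>j\<close>.\<close>
lemma descent_polynomial_gamma:
  "(\<Sum>xs \<in> linear_extensions r. (monom 1 (des (map l xs)) :: real poly)) =
     (\<Sum>j < card (Field r) div 2.
        of_nat (gamma (j + 1)) * (monom 1 j * [:1, 1:] ^ (card (Field r) - 2 - 2 * j)))"
proof -
  let ?d = "card (Field r)" and ?X = "monom 1 1 :: real poly"
  have des: "des (word xs) = Suc (des (map l xs))" if "xs \<in> linear_extensions r" for xs
    using linear_extension_nonempty[OF that] c_less_last[OF that]
    by (simp add: word_def des_append_last)
  have "linear_extensions r = (\<Union>j \<in> {..<?d div 2}. peak_class (j + 1))"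
  proof (intro equalityI subsetI)
    fix xs assume xs: "xs \<in> linear_extensions r"
    then have "peak_class (peak (word xs)) \<noteq> {}" by (auto simp: peak_class_def)
    from peak_class_nonempty_bounds[OF this] have "peak (word xs) - 1 \<in> {..<?d div 2}"
      and "xs \<in> peak_class (peak (word xs) - 1 + 1)" using xs by (auto simp: peak_class_def)
    then show "xs \<in> (\<Union>j \<in> {..<?d div 2}. peak_class (j + 1))" by blast
  qed (auto simp: peak_class_def)
  then have "?X * (\<Sum>xs \<in> linear_extensions r. monom 1 (des (map l xs))) =
      (\<Sum>xs \<in> (\<Union>j \<in> {..<?d div 2}. peak_class (j + 1)). monom 1 (des (word xs)))"
    by (auto simp: sum_distrib_left des mult_monom intro!: sum.cong)
  also have "\<dots> = (\<Sum>j < ?d div 2. \<Sum>xs \<in> peak_class (j + 1). monom 1 (des (word xs)))"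
    by (rule sum.UNION_disjoint) (auto simp: finite_peak_class, auto simp: peak_class_def)
  also have "\<dots> = ?X * (\<Sum>j < ?d div 2.
        of_nat (gamma (j + 1)) * (monom 1 j * [:1, 1:] ^ (?d - 2 - 2 * j)))"
    unfolding peak_class_des_polynomial sum_distrib_left
  proof (rule sum.cong[OF refl])
    fix j
    have "monom 1 (j + 1) = ?X * monom 1 j" by (simp add: mult_monom)
    then show "of_nat (gamma (j + 1)) * (monom 1 (j + 1) * [:1, 1:] ^ (?d - 2 * (j + 1))) =
        ?X * (of_nat (gamma (j + 1)) * (monom 1 j * [:1, 1:] ^ (?d - 2 - 2 * j)))"
      by (simp only: mult_ac) simp
  qed
  finally show ?thesis by simp
qed

lemma h_star_gamma:
  "h_star (card (Field r)) (order_polytope r) =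
     (\<Sum>j < card (Field r) div 2.
        of_nat (gamma (j + 1)) * (monom 1 j * [:1, 1:] ^ (card (Field r) - 2 - 2 * j)))"
  unfolding h_star_order_polytope[OF finite_Field natural_labeling_l]
  by (rule descent_polynomial_gamma)

end

section \<open>Adjoining a greatest element\<close>

lemma Field_adjoin_top: "Field (adjoin_top r) = insert None (Some ` Field r)"
  by (auto simp: adjoin_top_def Field_def)

text \<open>The greatest element must come last.\<close>
lemma linear_extensions_adjoin_top:
  "linear_extensions (adjoin_top r) = (\<lambda>xs. map Some xs @ [None]) ` linear_extensions r"
proof (intro equalityI subsetI)
  note F = Field_adjoin_top[of r]
  have in_r: "(Some x, Some y) \<in> adjoin_top r \<longleftrightarrow> (x, y) \<in> r" for x y
    by (auto simp: adjoin_top_def)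
  {
    fix zs assume zs: "zs \<in> linear_extensions (adjoin_top r)"
    then have d: "distinct zs" and s: "set zs = insert None (Some ` Field r)"
      and w: "sorted_wrt (\<lambda>x y. (y, x) \<notin> adjoin_top r) zs"
      by (auto simp: linear_extensions_iff F)
    obtain u v where uv: "zs = u @ None # v" using s by (metis insertI1 split_list)
    have "v = []"
    proof (rule ccontr)
      assume "v \<noteq> []"
      then have "hd v \<in> set v" by simp
      moreover have "hd v \<noteq> None" using d uv \<open>hd v \<in> set v\<close> by auto
      moreover have "hd v \<in> insert None (Some ` Field r)"
        unfolding s[symmetric] using uv \<open>hd v \<in> set v\<close> by simp
      ultimately have "hd v \<in> Some ` Field r" by (metis insertE)
      then have "(hd v, None) \<in> adjoin_top r" by (auto simp: adjoin_top_def)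
      then show False using w uv \<open>hd v \<in> set v\<close> by (auto simp: sorted_wrt_append)
    qed
    define xs where "xs = map the u"
    have "insert None (set u) = insert None (Some ` Field r)" using s uv \<open>v = []\<close> by simp
    moreover have "None \<notin> set u" using d uv by simp
    ultimately have us: "set u = Some ` Field r" by (metis image_iff insert_ident option.distinct(1))
    then have u: "u = map Some xs" unfolding xs_def map_map
      by (intro map_idI[symmetric]) auto
    have "set xs = Field r" using us by (auto simp: xs_def image_image)
    then have "xs \<in> linear_extensions r"
      using d w by (auto simp: linear_extensions_iff uv u distinct_map sorted_wrt_append
        sorted_wrt_map in_r)
    then show "zs \<in> (\<lambda>xs. map Some xs @ [None]) ` linear_extensions r"
      using uv u \<open>v = []\<close> by auto
  }
  {
    fix zs assume "zs \<in> (\<lambda>xs. map Some xs @ [None]) ` linear_extensions r"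
    then show "zs \<in> linear_extensions (adjoin_top r)"
      by (auto simp: linear_extensions_iff F distinct_map sorted_wrt_append sorted_wrt_map in_r)
        (auto simp: adjoin_top_def)
  }
qed

lemma JH_adjoin_top:
  "JH (adjoin_top r) \<omega> = (\<lambda>xs. map (\<lambda>x. \<omega> (Some x)) xs @ [\<omega> None]) ` linear_extensions r"
proof -
  have "JH (adjoin_top r) \<omega> = map \<omega> ` linear_extensions (adjoin_top r)"
    by (auto simp: JH_def linear_extensions_def)
  then show ?thesis by (simp add: linear_extensions_adjoin_top image_image comp_def)
qed

text \<open>The saturated chains \<open>x \<prec> y \<prec> z\<close> up to the greatest element \<open>z\<close> fix the rank
  function: \<open>\<rho> x = 0\<close> by the empty sum, then \<open>\<rho> y = 1\<close> because \<open>-1\<close> is excluded, and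
  \<open>\<rho> z = 0\<close> because \<open>2\<close> is.\<close>
lemma (in two_level_poset) canonical_labeling_separates_levels:
  assumes can: "canonical_labeling (adjoin_top r) \<omega>"
  shows "inj_on \<omega> (insert None (Some ` Field r))"
    and "\<And>x y. x \<in> Field r \<Longrightarrow> y \<in> Field r \<Longrightarrow> \<not> hi x \<Longrightarrow> hi y \<Longrightarrow> \<omega> (Some x) < \<omega> (Some y)"
    and "\<And>y. y \<in> Field r \<Longrightarrow> hi y \<Longrightarrow> \<omega> None < \<omega> (Some y)"
proof -
  let ?t = "adjoin_top r"
  note F = Field_adjoin_top[of r]
  show "inj_on \<omega> (insert None (Some ` Field r))"
    using can by (simp add: canonical_labeling_def labeling_def F)
  obtain \<rho> :: "'a option \<Rightarrow> int"
    where chain: "\<And>xs. saturated_chain_from_min ?t xs \<Longrightarrow>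
           \<rho> (last xs) = (\<Sum>i<length xs - 1. edge_sign \<omega> (xs ! i) (xs ! Suc i))"
      and range: "\<And>x. x \<in> Field ?t \<Longrightarrow> \<rho> x \<in> {0, 1}"
      and mono: "\<And>x y. x \<in> Field ?t \<Longrightarrow> y \<in> Field ?t \<Longrightarrow> \<rho> x < \<rho> y \<Longrightarrow> \<omega> x < \<omega> y"
    using can unfolding canonical_labeling_def by blast
  have sign: "edge_sign \<omega> x y = 1 \<or> edge_sign \<omega> x y = -1" for x y
    by (simp add: edge_sign_def)
  have min: "minimal_in ?t (Some x)" if "x \<in> Field r" "\<not> hi x" for x
    using that levels by (auto simp: minimal_in_def F) (auto simp: adjoin_top_def)
  have \<rho>lo: "\<rho> (Some x) = 0" if "x \<in> Field r" "\<not> hi x" for x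
    using chain[of "[Some x]"] min[OF that] by (simp add: saturated_chain_from_min_def)
  have hi_top: "\<rho> (Some y) = 1 \<and> \<rho> None = 0" if y: "y \<in> Field r" "hi y" for y
  proof -
    obtain x where x: "\<not> hi x" "(x, y) \<in> r" using below[OF y] by blast
    have xF: "x \<in> Field r" using x(2) by (rule FieldI1)
    have xy: "covered_by ?t (Some x) (Some y)"
      using x y levels unfolding covered_by_def by (auto simp: adjoin_top_def)
    have yt: "covered_by ?t (Some y) None"
      using y levels unfolding covered_by_def by (auto simp: adjoin_top_def)
    have "saturated_chain_from_min ?t [Some x, Some y]"
      using min[OF xF x(1)] xy by (simp add: saturated_chain_from_min_def)
    from chain[OF this] have 1: "\<rho> (Some y) = edge_sign \<omega> (Some x) (Some y)" by simp
    have "saturated_chain_from_min ?t [Some x, Some y, None]"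
      using min[OF xF x(1)] xy yt by (simp add: saturated_chain_from_min_def)
    from chain[OF this] have 2: "\<rho> None = \<rho> (Some y) + edge_sign \<omega> (Some y) None"
      by (simp add: 1 lessThan_Suc numeral_2_eq_2)
    show ?thesis
      using 1 2 range[of "Some y"] range[of None] sign[of "Some x" "Some y"] sign[of "Some y" None] y
      by (auto simp: F)
  qed
  show "\<omega> (Some x) < \<omega> (Some y)" if "x \<in> Field r" "y \<in> Field r" "\<not> hi x" "hi y" for x y
    using mono[of "Some x" "Some y"] \<rho>lo[of x] hi_top[of y] that by (simp add: F)
  show "\<omega> None < \<omega> (Some y)" if "y \<in> Field r" "hi y" for y
    using mono[of None "Some y"] hi_top[of y] that by (simp add: F)
qed

lemma (in two_level_poset) separated_labeling_if_canonical:
  assumes "canonical_labeling (adjoin_top r) \<omega>"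
  shows "separated_labeling r hi (\<lambda>x. \<omega> (Some x)) (\<omega> None)"
proof
  note \<omega> = canonical_labeling_separates_levels[OF assms]
  show "inj_on (\<lambda>x. \<omega> (Some x)) (Field r)" using \<omega>(1) by (auto simp: inj_on_def)
  show "\<omega> None \<notin> (\<lambda>x. \<omega> (Some x)) ` Field r" using \<omega>(1) by (auto simp: inj_on_def)
qed (use canonical_labeling_separates_levels[OF assms] in auto)

section \<open>The \<open>\<gamma>\<close>-expansion for the crown poset\<close>

text \<open>The \<open>j\<close>-th polynomial starts with \<open>t^j\<close>, so the coefficients can be read off one after
  the other.\<close>
lemma gamma_basis_coefficients_unique:
  fixes a b :: "nat \<Rightarrow> nat"
  assumes eq: "(\<Sum>j<n. of_nat (a j) * (monom 1 j * [:1, 1:] ^ e j)) =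
      (\<Sum>j<n. of_nat (b j) * (monom 1 j * [:1, 1 :: real:] ^ e j))"
    and "k < n"
  shows "a k = b k"
  using assms(2)
proof (induction k rule: less_induct)
  case (less k)
  let ?p = "\<lambda>j. monom 1 j * [:1, 1 :: real:] ^ e j"
  have low: "coeff (?p j) k = 0" if "k < j" for j
    using that by (simp add: coeff_monom_mult)
  have diag: "coeff (?p k) k = 1"
    by (simp add: coeff_monom_mult coeff_0_power)
  have "(\<Sum>j<n. (real (a j) - real (b j)) * coeff (?p j) k) = 0"
    using arg_cong[OF eq, of "\<lambda>p. coeff p k"]
    by (simp add: coeff_sum of_nat_poly algebra_simps sum_subtractf)
  moreover have "(\<Sum>j<n. (real (a j) - real (b j)) * coeff (?p j) k) =
      (\<Sum>j\<in>{k}. (real (a j) - real (b j)) * coeff (?p j) k)"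
  proof (rule sum.mono_neutral_right)
    show "\<forall>j \<in> {..<n} - {k}. (real (a j) - real (b j)) * coeff (?p j) k = 0"
    proof
      fix j assume j: "j \<in> {..<n} - {k}"
      then consider "j < k" | "k < j" by force
      then show "(real (a j) - real (b j)) * coeff (?p j) k = 0"
        using less.IH[of j] less.prems low[of j] by cases simp_all
    qed
  qed (use less.prems in auto)
  ultimately show ?case by (simp add: diag)
qed

lemma crown_covers_levels:
  "(x, y) \<in> crown_covers n \<Longrightarrow> odd x \<and> even y"
  by (auto simp: crown_covers_def)

text \<open>Covers lead from odd to even numbers and cannot be composed.\<close>
lemma crown_eq: "crown n = Id_on {1..2 * n} \<union> crown_covers n"
proof -
  have "trans (crown_covers n)"
    by (rule transI) (use crown_covers_levels in blast)
  then show ?thesis by (simp add: crown_def)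
qed

lemma Field_crown: "1 \<le> n \<Longrightarrow> Field (crown n) = {1..2 * n}"
  by (auto simp: crown_eq Field_def crown_covers_def)

lemma two_level_poset_crown:
  assumes "1 \<le> n"
  shows "two_level_poset (crown n) even"
proof
  have cover: "(2 * i - 1, 2 * i) \<in> crown n" if "1 \<le> i" "i \<le> n" for i
    using that by (auto simp: crown_eq crown_covers_def)
  show "finite (Field (crown n))" "Field (crown n) \<noteq> {}"
    using assms by (auto simp: Field_crown)
  show "odd x \<and> even y" if "(x, y) \<in> crown n" "x \<noteq> y" for x y
    using that crown_covers_levels by (auto simp: crown_eq)
  show "\<exists>y. even y \<and> (x, y) \<in> crown n" if "x \<in> Field (crown n)" "odd x" for x
  proof -
    from that(2) obtain m where "x = 2 * m + 1" by (rule oddE)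
    then show ?thesis using cover[of "m + 1"] that(1) assms
      by (intro exI[of _ "2 * m + 2"]) (auto simp: Field_crown)
  qed
  show "\<exists>x. odd x \<and> (x, y) \<in> crown n" if "y \<in> Field (crown n)" "even y" for y
  proof -
    from that(2) obtain m where "y = 2 * m" by (rule evenE)
    then show ?thesis using cover[of m] that(1) assms
      by (intro exI[of _ "2 * m - 1"]) (auto simp: Field_crown)
  qed
qed

text \<open>Any labeling that separates the levels serves to define the coefficients; negating the
  labels of the odd numbers is one.\<close>
lemma separated_labeling_crown:
  assumes "1 \<le> n"
  shows "separated_labeling (crown n) even (\<lambda>i. if even i then int i else - int i) 0"
proof -
  interpret two_level_poset "crown n" even by (rule two_level_poset_crown[OF assms])
  show ?thesis
  proof
    show "inj_on (\<lambda>i. if even i then int i else - int i) (Field (crown n))"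
      by (auto simp: inj_on_def split: if_splits)
  qed (use assms in \<open>auto simp: Field_crown\<close>)
qed

theorem theorem5p19:
  fixes n :: nat
  assumes "n \<ge> 1"
  shows "\<exists>\<gamma> :: nat \<Rightarrow> nat.
    h_star (2 * n) (order_polytope (crown n)) =
      (\<Sum>j = 0..n - 1. of_nat (\<gamma> j) * (monom 1 j * [:1, 1:] ^ (2 * n - 2 - 2 * j))) \<and>
    (\<forall>(\<omega> :: nat \<Rightarrow> int) (\<omega>' :: nat option \<Rightarrow> int).
       natural_labeling (crown n) \<omega> \<longrightarrow>
       canonical_labeling (adjoin_top (crown n)) \<omega>' \<longrightarrow>
       (\<forall>j \<in> {0..n - 1}. real (\<gamma> j) =
          2 powi (- 2 * int n + 2 + 2 * int j) *
          real (card {\<pi> \<in> JH (adjoin_top (crown n)) \<omega>'. peak \<pi> = j + 1})))"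
proof -
  let ?P = "\<lambda>j. monom 1 j * [:1, 1 :: real:] ^ (2 * n - 2 - 2 * j)"
  \<comment> \<open>The coefficients are defined by one labeling; uniqueness transfers them to all canonical ones.\<close>
  interpret ref: separated_labeling "crown n" even "\<lambda>i. if even i then int i else - int i" 0
    by (rule separated_labeling_crown[OF assms])
  define \<gamma> where "\<gamma> j = ref.gamma (j + 1)" for j
  have d: "card (Field (crown n)) = 2 * n" by (simp add: Field_crown[OF assms])
  have range: "{0..n - 1} = {..<n}" using assms by auto
  have h: "h_star (2 * n) (order_polytope (crown n)) = (\<Sum>j<n. of_nat (\<gamma> j) * ?P j)"
    using ref.h_star_gamma by (simp add: d \<gamma>_def)
  have "real (\<gamma> j) = 2 powi (- 2 * int n + 2 + 2 * int j) *
      real (card {\<pi> \<in> JH (adjoin_top (crown n)) \<omega>. peak \<pi> = j + 1})"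
    if \<omega>: "canonical_labeling (adjoin_top (crown n)) \<omega>" and j: "j < n" for \<omega> j
  proof -
    interpret can: separated_labeling "crown n" even "\<lambda>x. \<omega> (Some x)" "\<omega> None"
      by (rule ref.separated_labeling_if_canonical[OF \<omega>])
    have "(\<Sum>j<n. of_nat (\<gamma> j) * ?P j) = (\<Sum>j<n. of_nat (can.gamma (j + 1)) * ?P j)"
      using h can.h_star_gamma by (simp add: d)
    then have \<gamma>j: "\<gamma> j = can.gamma (j + 1)" by (rule gamma_basis_coefficients_unique) (rule j)
    have "{\<pi> \<in> JH (adjoin_top (crown n)) \<omega>. peak \<pi> = j + 1} = can.word ` can.peak_class (j + 1)"
      by (auto simp: JH_adjoin_top can.peak_class_def can.word_def)
    moreover have "inj_on can.word (can.peak_class (j + 1))"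
      by (rule inj_on_subset[OF can.inj_on_word]) (auto simp: can.peak_class_def)
    ultimately have "card {\<pi> \<in> JH (adjoin_top (crown n)) \<omega>. peak \<pi> = j + 1} =
        2 ^ (2 * n - 2 * (j + 1)) * \<gamma> j"
      using can.card_peak_class[of "j + 1"] j by (simp add: card_image d \<gamma>j)
    moreover have "- 2 * int n + 2 + 2 * int j = - int (2 * n - 2 * (j + 1))" using j by simp
    ultimately show ?thesis by (simp only: power_int_minus power_int_of_nat) simp
  qed
  then show ?thesis unfolding range using h by (intro exI[of _ \<gamma>]) auto
qed

end
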